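(* In the setting below, let $(\varepsilon_N)\subset[0,\infty)$ with $\varepsilon_N\to0$, and let $(\bar u_N)$ be a sequence of random vectors with values in $\mathcal D(\psi)$ such that $\hat\Psi_N(\bar u_N)\le\varepsilon_N$ with probability one. Then (i) $\Psi(\bar u_N)\to0$ as $N\to\infty$ with probability one, and (ii) for almost all $\omega\in\Omega$, $(\bar u_N(\omega))$ has at least one weak accumulation point in $U$, and every such point is a zero of $\Psi$.
   Context: Let $U$ be a separable Hilbert space (identified with its dual, inner product $(\cdot,\cdot)_U$), $W$ a separable Banach space with dual $W^*$, and $B:U\to W$ a compact linear operator with adjoint $B^*:W^*\to U$. Let $\psi:U\to[0,\infty]$ be proper, closed and convex with bounded domain $\mathcal D(\psi)=\{u\in U:\psi(u)<\infty\}$. Let $U_0\subset U$ be open, convex and bounded with $\mathcal D(\psi)\subset U_0$. Let $\Xi$ be a complete separable metric space (with Borel $\sigma$-field), $\boldsymbol\xi$ a $\Xi$-valued random element, and $\boldsymbol\xi^1,\boldsymbol\xi^2,\ldots$ independent $\Xi$-valued random elements on a complete probability space $(\Omega,\mathcal F,P)$, each distributed as $\boldsymbol\xi$. Let $f:B(U_0)\times\Xi\to\mathbb R$ be such that $f(\cdot,\xi)$ is continuous on $B(\mathcal D(\psi))$ for each $\xi$, $f(w,\cdot)$ is measurable for each $w\in B(U_0)$, and $|f(Bu,\xi)|\le \zeta_f(\xi)$ for all $(u,\xi)\in U_0\times\Xi$ with $\zeta_f$ integrable. Assume further: for each $\xi$, $g_\xi:U_0\to\mathbb R$, $g_\xi(u)=f(Bu,\xi)$,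 is continuously differentiable; there is a Carathéodory map $\mathrm D_wf:B(\mathcal D(\psi))\times\Xi\to W^*$ with $\nabla g_\xi(u)=B^*\mathrm D_wf(Bu,\xi)$ for all $(u,\xi)\in\mathcal D(\psi)\times\Xi$; and there is an integrable $\zeta_{\mathrm Df}:\Xi\to[0,\infty)$ with $\|\nabla g_\xi(u)\|_U\le\zeta_{\mathrm Df}(\xi)$ on $U_0\times\Xi$ and $\|\mathrm D_wf(Bu,\xi)\|_{W^*}\le\zeta_{\mathrm Df}(\xi)$ on $\mathcal D(\psi)\times\Xi$. Define, for $w\in B(\mathcal D(\psi))$, $\mathrm DF(w)=\mathbb E[\mathrm D_wf(w,\boldsymbol\xi)]$ and $\mathrm D\hat F_N(w)=\frac1N\sum_{i=1}^N\mathrm D_wf(w,\boldsymbol\xi^i)$, and the gap functionals $\Psi,\hat\Psi_N:\mathcal D(\psi)\to[0,\infty]$, $\Psi(u)=\sup_{v\in\mathcal D(\psi)}[(B^*\mathrm DF(Bu),u-v)_U+\psi(u)-\psi(v)]$, $\hat\Psi_N(u)=\sup_{v\in\mathcal D(\psi)}[(B^*\mathrm D\hat F_N(Bu),u-v)_U+\psi(u)-\psi(v)]$. *)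

theory Defs
  imports "HOL-Probability.Probability"
begin

definition dom_fun :: "('u \<Rightarrow> ereal) \<Rightarrow> 'u set" where
  "dom_fun \<psi> = {u. \<psi> u < \<infinity>}"

definition closed_fun :: "('u::topological_space \<Rightarrow> ereal) \<Rightarrow> bool" where
  "closed_fun \<psi> \<longleftrightarrow> closed {(u, t::real). \<psi> u \<le> ereal t}"

definition convex_fun :: "('u::real_vector \<Rightarrow> ereal) \<Rightarrow> bool" where
  "convex_fun \<psi> \<longleftrightarrow> convex {(u, t::real). \<psi> u \<le> ereal t}"

definition proper_fun :: "('u \<Rightarrow> ereal) \<Rightarrow> bool" where
  "proper_fun \<psi> \<longleftrightarrow> (\<forall>u. \<psi> u \<noteq> -\<infinity>) \<and> dom_fun \<psi> \<noteq> {}"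

definition compact_operator :: "('u::real_normed_vector \<Rightarrow> 'w::real_normed_vector) \<Rightarrow> bool" where
  "compact_operator B \<longleftrightarrow> bounded_linear B \<and> compact (closure (B ` cball 0 1))"

text \<open>Expectation of a dual-space valued random element, taken weak-star (Gelfand):
  the functional z \<mapsto> E[G z].\<close>
definition dual_expectation :: "'a measure \<Rightarrow> ('a \<Rightarrow> ('w::real_normed_vector \<Rightarrow>\<^sub>L real)) \<Rightarrow> ('w \<Rightarrow>\<^sub>L real)" where
  "dual_expectation M G = Blinfun (\<lambda>z. \<integral>\<omega>. blinfun_apply (G \<omega>) z \<partial>M)"

text \<open>Gap functional: d is the gradient vector (here B^* DF(Bu) resp. B^* D\<hat>F_N(Bu)).\<close>
definition gap :: "('u::real_inner \<Rightarrow> ereal) \<Rightarrow> 'u \<Rightarrow> 'u \<Rightarrow> ereal" where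
  "gap \<psi> d u = (SUP v\<in>dom_fun \<psi>. ereal (inner d (u - v) + real_of_ereal (\<psi> u) - real_of_ereal (\<psi> v)))"

text \<open>Weak convergence in a Hilbert space (dual identified with the space via Riesz).\<close>
definition weakly_converges :: "(nat \<Rightarrow> 'u::real_inner) \<Rightarrow> 'u \<Rightarrow> bool" where
  "weakly_converges x u \<longleftrightarrow> (\<forall>v. (\<lambda>n. inner (x n) v) \<longlonglongrightarrow> inner u v)"

definition weak_accumulation_point :: "(nat \<Rightarrow> 'u::real_inner) \<Rightarrow> 'u \<Rightarrow> bool" where
  "weak_accumulation_point x u \<longleftrightarrow> (\<exists>r. strict_mono r \<and> weakly_converges (x \<circ> r) u)"

end

theory Submission
  imports Defs "HOL-Complex_Analysis.Great_Picard"
begin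

text \<open>
  By the strong law of large numbers the empirical derivatives are eventually bounded by a
  deterministic constant, so a small empirical gap forces the iterates into a fixed sublevel set
  of \<open>\<psi>\<close>. This set is closed, convex and bounded, hence weakly sequentially compact, and the compact
  operator \<open>B\<close> maps it onto a norm-compact set.

  The gaps at \<open>u\<close> see the derivatives only through the pairings \<open>D\<^sub>wf(w, \<xi>) z\<close> with \<open>w = B u\<close> in this
  compact image and \<open>z\<close> in the compact closure of the image of the domain of \<open>\<psi>\<close>. A uniform law of
  large numbers for this real-valued integrand makes the two gaps uniformly close. Zeros of the
  limiting gap then follow from weak lower semicontinuity of \<open>\<psi>\<close>.
\<close>

section \<open>Independent and identically distributed families\<close>

definition (in prob_space) iid_vars ::
    "'b measure \<Rightarrow> 'b measure \<Rightarrow> ('i \<Rightarrow> 'a \<Rightarrow> 'b) \<Rightarrow> 'i set \<Rightarrow> bool" where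
  "iid_vars N Q X I \<longleftrightarrow> indep_vars (\<lambda>_. N) X I \<and> (\<forall>i\<in>I. distr M N (X i) = Q)"

context prob_space
begin

lemma indep_sets_reindex:
  assumes indep: "indep_sets F (f ` I)" and inj: "inj_on f I"
  shows "indep_sets (\<lambda>i. F (f i)) I"
  unfolding indep_sets_def
proof (intro conjI ballI allI impI)
  show "F (f i) \<subseteq> events" if "i \<in> I" for i
    using indep that by (auto simp: indep_sets_def)
  fix J A assume J: "J \<subseteq> I" "J \<noteq> {}" "finite J" and A: "A \<in> (\<Pi> j\<in>J. F (f j))"
  have inj_J: "inj_on f J" using inj J(1) by (rule inj_on_subset)
  let ?A = "\<lambda>k. A (inv_into J f k)"
  have "prob (\<Inter>k\<in>f ` J. ?A k) = (\<Prod>k\<in>f ` J. prob (?A k))"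
    using J A inj_J by (intro indep_setsD[OF indep]) auto
  then show "prob (\<Inter>j\<in>J. A j) = (\<Prod>j\<in>J. prob (A j))"
    using inj_J by (simp add: prod.reindex)
qed

lemma indep_vars_reindex:
  assumes "indep_vars M' X (f ` I)" "inj_on f I"
  shows "indep_vars (\<lambda>i. M' (f i)) (\<lambda>i. X (f i)) I"
  using assms indep_sets_reindex[of "\<lambda>i. {X i -` A \<inter> space M | A. A \<in> sets (M' i)}" f I]
  by (auto simp: indep_vars_def2)

lemma iid_vars_indep: "iid_vars N Q X I \<Longrightarrow> indep_vars (\<lambda>_. N) X I"
  by (simp add: iid_vars_def)

lemma iid_vars_distr: "iid_vars N Q X I \<Longrightarrow> i \<in> I \<Longrightarrow> distr M N (X i) = Q"
  by (simp add: iid_vars_def)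

lemma iid_vars_measurable: "iid_vars N Q X I \<Longrightarrow> i \<in> I \<Longrightarrow> X i \<in> M \<rightarrow>\<^sub>M N"
  by (simp add: iid_vars_def indep_vars_def)

lemma iid_vars_sets: "iid_vars N Q X I \<Longrightarrow> i \<in> I \<Longrightarrow> sets Q = sets N"
  using sets_distr[of M N "X i"] by (simp add: iid_vars_distr)

lemma iid_vars_borel_measurable:
  "iid_vars N Q X I \<Longrightarrow> i \<in> I \<Longrightarrow> h \<in> borel_measurable Q \<longleftrightarrow> h \<in> borel_measurable N"
  by (simp add: measurable_cong_sets[OF iid_vars_sets refl])

lemma
  fixes h :: "'b \<Rightarrow> real"
  assumes iid: "iid_vars N Q X I" and i: "i \<in> I" and h: "integrable Q h"
  shows iid_vars_integrable: "integrable M (\<lambda>\<omega>. h (X i \<omega>))"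
    and iid_vars_expectation: "expectation (\<lambda>\<omega>. h (X i \<omega>)) = (\<integral>x. h x \<partial>Q)"
proof -
  have h_meas: "h \<in> borel_measurable N"
    using borel_measurable_integrable[OF h] iid_vars_borel_measurable[OF iid i] by blast
  note X = iid_vars_measurable[OF iid i] and Q = iid_vars_distr[OF iid i]
  show "integrable M (\<lambda>\<omega>. h (X i \<omega>))"
    using integrable_distr_eq[OF X h_meas] h Q by simp
  show "expectation (\<lambda>\<omega>. h (X i \<omega>)) = (\<integral>x. h x \<partial>Q)"
    using integral_distr[OF X h_meas] Q by simp
qed

lemma iid_vars_reindex:
  assumes iid: "iid_vars N Q X J" and "f ` I \<subseteq> J" "inj_on f I"
  shows "iid_vars N Q (\<lambda>i. X (f i)) I"
  using indep_vars_reindex[OF indep_vars_subset[OF iid_vars_indep[OF iid]]] assms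
  by (auto simp: iid_vars_def)

lemma iid_vars_expectation_path:
  fixes X :: "nat \<Rightarrow> 'a \<Rightarrow> 'b" and F :: "(nat \<Rightarrow> 'b) \<Rightarrow> real"
  assumes iid: "iid_vars N Q X UNIV" and F: "F \<in> borel_measurable (\<Pi>\<^sub>M i\<in>UNIV. N)"
  shows "expectation (\<lambda>\<omega>. F (\<lambda>i. X i \<omega>)) = (\<integral>y. F y \<partial>(\<Pi>\<^sub>M i\<in>UNIV. Q))"
proof -
  note [measurable] = iid_vars_measurable[OF iid UNIV_I]
  have "distr M (\<Pi>\<^sub>M i\<in>UNIV. N) (\<lambda>\<omega> i. X i \<omega>) = (\<Pi>\<^sub>M i\<in>UNIV. distr M N (X i))"
    using iid_vars_indep[OF iid] by (simp add: indep_vars_iff_distr_eq_PiM restrict_def)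
  then have "distr M (\<Pi>\<^sub>M i\<in>UNIV. N) (\<lambda>\<omega> i. X i \<omega>) = (\<Pi>\<^sub>M i\<in>UNIV. Q)"
    by (simp add: iid_vars_distr[OF iid])
  moreover have "(\<lambda>\<omega> i. X i \<omega>) \<in> M \<rightarrow>\<^sub>M (\<Pi>\<^sub>M i\<in>UNIV. N)"
    by (rule measurable_abs_UNIV) measurable
  ultimately show ?thesis using F integral_distr by metis
qed

lemma measurable_path_tail_sigma:
  fixes X :: "nat \<Rightarrow> 'a \<Rightarrow> 'b"
  assumes X: "\<And>i. X i \<in> M \<rightarrow>\<^sub>M N"
  shows "(\<lambda>\<omega> i. X (m + i) \<omega>) \<in>
    sigma (space M) (\<Union>i\<in>{m..}. {X i -` A \<inter> space M | A. A \<in> sets N}) \<rightarrow>\<^sub>M (\<Pi>\<^sub>M i\<in>UNIV. N)"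
proof (rule measurable_abs_UNIV)
  let ?T = "sigma (space M) (\<Union>i\<in>{m..}. {X i -` A \<inter> space M | A. A \<in> sets N})"
  have sets_T: "sets ?T = sigma_sets (space M) (\<Union>i\<in>{m..}. {X i -` A \<inter> space M | A. A \<in> sets N})"
    by (rule sets_measure_of) auto
  have space_T: "space ?T = space M" by (rule space_measure_of) auto
  show "(\<lambda>\<omega>. X (m + i) \<omega>) \<in> ?T \<rightarrow>\<^sub>M N" for i
  proof (rule measurableI)
    show "X (m + i) \<omega> \<in> space N" if "\<omega> \<in> space ?T" for \<omega>
      using that measurable_space[OF X] space_T by auto
    show "X (m + i) -` A \<inter> space ?T \<in> sets ?T" if "A \<in> sets N" for A
      unfolding sets_T space_T using that
      by (intro sigma_sets.Basic UN_I[of "m + i"]) auto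
  qed
qed

lemma shift_invariant_zero_one:
  fixes X :: "nat \<Rightarrow> 'a \<Rightarrow> 'b"
  assumes indep: "indep_vars (\<lambda>_. N) X UNIV"
    and S: "S \<in> sets (\<Pi>\<^sub>M i\<in>UNIV. N)"
    and shift: "\<And>y. y \<in> space (\<Pi>\<^sub>M i\<in>UNIV. N) \<Longrightarrow> (\<lambda>i. y (Suc i)) \<in> S \<longleftrightarrow> y \<in> S"
  shows "(AE \<omega> in M. (\<lambda>i. X i \<omega>) \<in> S) \<or> (AE \<omega> in M. (\<lambda>i. X i \<omega>) \<notin> S)"
proof -
  define A where "A i = sigma_sets (space M) {X i -` B \<inter> space M | B. B \<in> sets N}" for i
  define T where "T = {\<omega> \<in> space M. (\<lambda>i. X i \<omega>) \<in> S}"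
  have X: "X i \<in> M \<rightarrow>\<^sub>M N" for i using indep by (auto simp: indep_vars_def)
  have shift_add: "(\<lambda>i. y (m + i)) \<in> S \<longleftrightarrow> y \<in> S" if "\<And>i. y i \<in> space N" for y m
  proof (induction m)
    case (Suc m)
    have "(\<lambda>i. y (m + i)) \<in> space (\<Pi>\<^sub>M i\<in>UNIV. N)" using that by (auto simp: space_PiM)
    from shift[OF this] Suc show ?case by simp
  qed simp
  have "T \<in> tail_events A"
    unfolding tail_events_def
  proof
    fix m
    let ?G = "\<Union>i\<in>{m..}. {X i -` B \<inter> space M | B. B \<in> sets N}"
    have "(\<lambda>\<omega> i. X (m + i) \<omega>) -` S \<inter> space (sigma (space M) ?G) \<in> sets (sigma (space M) ?G)"
      using measurable_path_tail_sigma[OF X] S by (rule measurable_sets)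
    moreover have "?G \<subseteq> Pow (space M)" by auto
    moreover have "(\<lambda>\<omega> i. X (m + i) \<omega>) -` S \<inter> space M = T"
      using shift_add[of "\<lambda>i. X i _" m] measurable_space[OF X] by (auto simp: T_def)
    ultimately have "T \<in> sigma_sets (space M) ?G" by (simp add: sets_measure_of space_measure_of)
    also have "\<dots> \<subseteq> sigma_sets (space M) (\<Union>(A ` {m..}))"
      unfolding A_def by (intro sigma_sets_mono' UN_mono) auto
    finally show "T \<in> sigma_sets (space M) (\<Union>(A ` {m..}))" .
  qed
  moreover have "sigma_algebra (space M) (A i)" for i
    unfolding A_def by (rule sigma_algebra_sigma_sets) auto
  moreover have "indep_sets A UNIV" using indep unfolding indep_vars_def A_def by simp
  ultimately have "prob T = 0 \<or> prob T = 1" by (intro kolmogorov_0_1_law[of A])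
  moreover have "T \<in> events"
  proof -
    have "(\<lambda>\<omega> i. X i \<omega>) \<in> M \<rightarrow>\<^sub>M (\<Pi>\<^sub>M i\<in>UNIV. N)"
      using X by (rule measurable_abs_UNIV)
    from measurable_sets[OF this S] show ?thesis by (simp add: T_def vimage_def Int_def conj_commute)
  qed
  ultimately have "(AE \<omega> in M. \<omega> \<in> T) \<or> (AE \<omega> in M. \<omega> \<notin> T)" by (metis prob_eq_0 prob_eq_1)
  then show ?thesis by (auto simp: T_def)
qed

end

section \<open>The strong law of large numbers\<close>

lemma bdd_above_iff_nat_bound:
  fixes f :: "'i \<Rightarrow> real"
  shows "bdd_above (range f) \<longleftrightarrow> (\<exists>b::nat. \<forall>i. f i \<le> real b)"
proof
  assume "bdd_above (range f)"
  then obtain c where "\<And>i. f i \<le> c" by (auto simp: bdd_above_def)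
  then have "f i \<le> real (nat \<lceil>c\<rceil>)" for i by (rule order_trans) (rule real_nat_ceiling_ge)
  then show "\<exists>b::nat. \<forall>i. f i \<le> real b" by blast
qed (auto simp: bdd_above_def)

lemma bdd_above_partial_sums_shift:
  fixes y :: "nat \<Rightarrow> real"
  shows "bdd_above (range (\<lambda>n. \<Sum>i<n. y (Suc i))) \<longleftrightarrow> bdd_above (range (\<lambda>n. \<Sum>i<n. y i))"
proof -
  have sum_shift: "(\<Sum>i<Suc n. y i) = y 0 + (\<Sum>i<n. y (Suc i))" for n
    by (rule sum.lessThan_Suc_shift)
  show ?thesis
  proof
    assume "bdd_above (range (\<lambda>n. \<Sum>i<n. y (Suc i)))"
    then obtain b where b: "\<And>n. (\<Sum>i<n. y (Suc i)) \<le> b" by (auto simp: bdd_above_def)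
    have "(\<Sum>i<n. y i) \<le> max 0 (y 0 + b)" for n
      using b[of "n - 1"] sum_shift[of "n - 1"] by (cases n) auto
    then show "bdd_above (range (\<lambda>n. \<Sum>i<n. y i))" by (auto simp: bdd_above_def)
  next
    assume "bdd_above (range (\<lambda>n. \<Sum>i<n. y i))"
    then obtain b where b: "\<And>n. (\<Sum>i<n. y i) \<le> b" by (auto simp: bdd_above_def)
    have "(\<Sum>i<n. y (Suc i)) \<le> b - y 0" for n
      using b[of "Suc n"] unfolding sum_shift by simp
    then show "bdd_above (range (\<lambda>n. \<Sum>i<n. y (Suc i)))" by (auto simp: bdd_above_def)
  qed
qed

definition max_partial_sum :: "nat \<Rightarrow> (nat \<Rightarrow> real) \<Rightarrow> real" where
  "max_partial_sum n y = (MAX k\<in>{..n}. \<Sum>i<k. y i)"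

lemma partial_sum_le_max_partial_sum: "k \<le> n \<Longrightarrow> (\<Sum>i<k. y i) \<le> max_partial_sum n y"
  unfolding max_partial_sum_def by (intro Max_ge) auto

lemma max_partial_sum_nonneg: "0 \<le> max_partial_sum n y"
  using partial_sum_le_max_partial_sum[of 0 n y] by simp

lemma max_partial_sum_mono: "m \<le> n \<Longrightarrow> max_partial_sum m y \<le> max_partial_sum n y"
  unfolding max_partial_sum_def by (intro Max_mono image_mono) auto

lemma max_partial_sum_Suc:
  "max_partial_sum (Suc n) y = max 0 (y 0 + max_partial_sum n (\<lambda>i. y (Suc i)))"
proof -
  have "max_partial_sum (Suc n) y = (MAX k\<in>insert 0 (Suc ` {..n}). \<Sum>i<k. y i)"
    unfolding max_partial_sum_def by (simp add: atMost_Suc_eq_insert_0)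
  also have "\<dots> = max 0 (MAX k\<in>{..n}. \<Sum>i<Suc k. y i)"
    by (simp add: image_image del: sum.lessThan_Suc)
  also have "(MAX k\<in>{..n}. \<Sum>i<Suc k. y i) = (MAX k\<in>{..n}. (\<Sum>i<k. y (Suc i)) + y 0)"
    by (simp add: sum.lessThan_Suc_shift add.commute del: sum.lessThan_Suc)
  also have "\<dots> = y 0 + max_partial_sum n (\<lambda>i. y (Suc i))"
    unfolding max_partial_sum_def by (subst Max_add_commute) auto
  finally show ?thesis .
qed

lemma borel_measurable_max_partial_sum [measurable]:
  "max_partial_sum n \<in> borel_measurable (\<Pi>\<^sub>M i\<in>UNIV. borel)"
  unfolding max_partial_sum_def by measurable

lemma integrable_max_partial_sum:
  "(\<And>i. integrable M (\<lambda>x. Y x i)) \<Longrightarrow> integrable M (\<lambda>x. max_partial_sum n (Y x))"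
  unfolding max_partial_sum_def by (intro integrable_MAX Bochner_Integration.integrable_sum) auto

context prob_space
begin

text \<open>By stationarity the expectation is the increment \<open>E[M\<^sub>n\<^sub>+\<^sub>1 - M\<^sub>n]\<close> of the maximal
  partial sums. If the partial sums were unbounded, it would tend to \<open>E[h(X\<^sub>0)]\<close>.\<close>

lemma garsia_inequality:
  fixes X :: "nat \<Rightarrow> 'a \<Rightarrow> 'b" and h :: "'b \<Rightarrow> real"
  assumes iid: "iid_vars N Q X UNIV" and int: "integrable Q h"
  shows "0 \<le> expectation (\<lambda>\<omega>. max (- max_partial_sum n (\<lambda>i. h (X (Suc i) \<omega>))) (h (X 0 \<omega>)))"
proof -
  let ?M = "\<lambda>n \<omega>. max_partial_sum n (\<lambda>i. h (X i \<omega>))"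
  let ?S = "\<lambda>n \<omega>. max_partial_sum n (\<lambda>i. h (X (Suc i) \<omega>))"
  have h [measurable]: "h \<in> borel_measurable N"
    using int iid_vars_borel_measurable[OF iid UNIV_I] by auto
  have int_M: "integrable M (?M n)" and int_S: "integrable M (?S n)" for n
    using iid_vars_integrable[OF iid UNIV_I int] by (auto intro: integrable_max_partial_sum)
  have "(\<lambda>y i. h (y i)) \<in> (\<Pi>\<^sub>M i\<in>(UNIV::nat set). N) \<rightarrow>\<^sub>M (\<Pi>\<^sub>M i\<in>UNIV. borel)"
    by (rule measurable_abs_UNIV) measurable
  then have "(\<lambda>y. max_partial_sum n (\<lambda>i. h (y i))) \<in> borel_measurable (\<Pi>\<^sub>M i\<in>UNIV. N)"
    by (rule measurable_compose) simp
  note path = iid_vars_expectation_path[OF _ this]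
  have "iid_vars N Q (\<lambda>i. X (Suc i)) UNIV"
    using iid by (rule iid_vars_reindex) auto
  then have stationary: "expectation (?S n) = expectation (?M n)"
    using path[OF iid] path[of Q "\<lambda>i. X (Suc i)"] by simp
  have "0 \<le> expectation (?M (Suc n)) - expectation (?M n)"
    using int_M by (simp add: integral_mono max_partial_sum_mono)
  also have "\<dots> = expectation (\<lambda>\<omega>. ?M (Suc n) \<omega> - ?S n \<omega>)"
    using int_M int_S stationary by simp
  also have "\<dots> = expectation (\<lambda>\<omega>. max (- ?S n \<omega>) (h (X 0 \<omega>)))"
    by (intro Bochner_Integration.integral_cong) (auto simp: max_partial_sum_Suc max_def)
  finally show ?thesis .
qed

end

lemma tendsto_max_neg_max_partial_sum:
  assumes unbounded: "\<not> bdd_above (range (\<lambda>n. \<Sum>i<n. y i))"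
  shows "(\<lambda>n. max (- max_partial_sum n (\<lambda>i. y (Suc i))) (y 0)) \<longlonglongrightarrow> y 0"
proof -
  have "\<not> bdd_above (range (\<lambda>n. \<Sum>i<n. y (Suc i)))"
    using unbounded by (simp add: bdd_above_partial_sums_shift)
  then have "\<exists>k. - y 0 < (\<Sum>i<k. y (Suc i))" by (force simp: bdd_above_def not_le)
  then obtain k where k: "- y 0 < (\<Sum>i<k. y (Suc i))" by blast
  have "\<forall>\<^sub>F n in sequentially. y 0 = max (- max_partial_sum n (\<lambda>i. y (Suc i))) (y 0)"
    using eventually_ge_at_top[of k]
  proof eventually_elim
    case (elim n)
    then show ?case using k partial_sum_le_max_partial_sum[of k n "\<lambda>i. y (Suc i)"] by simp
  qed
  then show ?thesis by (rule Lim_transform_eventually[OF tendsto_const])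
qed

context prob_space
begin

lemma AE_bdd_above_partial_sums:
  fixes X :: "nat \<Rightarrow> 'a \<Rightarrow> 'b" and h :: "'b \<Rightarrow> real"
  assumes iid: "iid_vars N Q X UNIV" and int: "integrable Q h" and neg: "(\<integral>x. h x \<partial>Q) < 0"
  shows "AE \<omega> in M. bdd_above (range (\<lambda>n. \<Sum>i<n. h (X i \<omega>)))"
proof (rule ccontr)
  assume not_bdd: "\<not> ?thesis"
  let ?S = "\<lambda>n \<omega>. max_partial_sum n (\<lambda>i. h (X (Suc i) \<omega>))"
  let ?B = "{y :: nat \<Rightarrow> real. bdd_above (range (\<lambda>n. \<Sum>i<n. y i))}"
  have int_X: "integrable M (\<lambda>\<omega>. h (X i \<omega>))" for i
    by (rule iid_vars_integrable[OF iid UNIV_I int])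
  then have int_S: "integrable M (?S n)" for n by (rule integrable_max_partial_sum)
  have "h \<in> borel_measurable N" using int iid_vars_borel_measurable[OF iid UNIV_I] by auto
  then have indep: "indep_vars (\<lambda>_. borel) (\<lambda>i \<omega>. h (X i \<omega>)) UNIV"
    by (rule indep_vars_compose2[OF iid_vars_indep[OF iid]])
  have "{y \<in> space (\<Pi>\<^sub>M i\<in>UNIV. borel). \<exists>b::nat. \<forall>n. (\<Sum>i<n. y i) \<le> real b}
      \<in> sets (\<Pi>\<^sub>M i\<in>(UNIV::nat set). borel)"
    by measurable
  then have "?B \<in> sets (\<Pi>\<^sub>M i\<in>UNIV. borel)"
    by (simp add: bdd_above_iff_nat_bound space_PiM)
  from shift_invariant_zero_one[OF indep this]
  have unbounded: "AE \<omega> in M. \<not> bdd_above (range (\<lambda>n. \<Sum>i<n. h (X i \<omega>)))"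
    using not_bdd by (simp add: bdd_above_partial_sums_shift)
  have "(\<lambda>n. expectation (\<lambda>\<omega>. max (- ?S n \<omega>) (h (X 0 \<omega>)))) \<longlonglongrightarrow> expectation (\<lambda>\<omega>. h (X 0 \<omega>))"
  proof (rule integral_dominated_convergence[where w="\<lambda>\<omega>. \<bar>h (X 0 \<omega>)\<bar>"])
    show "AE \<omega> in M. (\<lambda>n. max (- ?S n \<omega>) (h (X 0 \<omega>))) \<longlonglongrightarrow> h (X 0 \<omega>)"
      using unbounded by eventually_elim (rule tendsto_max_neg_max_partial_sum)
    show "AE \<omega> in M. norm (max (- ?S n \<omega>) (h (X 0 \<omega>))) \<le> \<bar>h (X 0 \<omega>)\<bar>" for n
      using max_partial_sum_nonneg[of n "\<lambda>i. h (X (Suc i) _)"] by (intro AE_I2) (auto simp: max_def)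
  qed (use int_X int_S in \<open>auto intro: borel_measurable_integrable\<close>)
  then have "0 \<le> expectation (\<lambda>\<omega>. h (X 0 \<omega>))"
    by (rule LIMSEQ_le_const) (simp add: garsia_inequality[OF iid int])
  then show False using neg iid_vars_expectation[OF iid UNIV_I int] by simp
qed

lemma AE_eventually_average_less:
  fixes X :: "nat \<Rightarrow> 'a \<Rightarrow> 'b" and h :: "'b \<Rightarrow> real"
  assumes iid: "iid_vars N Q X UNIV" and int: "integrable Q h" and c: "(\<integral>x. h x \<partial>Q) < c"
  shows "AE \<omega> in M. (\<forall>\<^sub>F n in sequentially. (\<Sum>i<n. h (X i \<omega>)) / n < c)"
proof -
  obtain d where d: "(\<integral>x. h x \<partial>Q) < d" "d < c" using c dense by blast
  interpret Q: prob_space Q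
    using prob_space_distr[OF iid_vars_measurable[OF iid UNIV_I]] iid_vars_distr[OF iid UNIV_I]
    by simp
  have "AE \<omega> in M. bdd_above (range (\<lambda>n. \<Sum>i<n. h (X i \<omega>) - d))"
    using iid int d(1)
    by (intro AE_bdd_above_partial_sums[where h="\<lambda>x. h x - d"]) (auto simp: Q.prob_space)
  then show ?thesis
  proof eventually_elim
    case (elim \<omega>)
    then obtain b where b: "(\<Sum>i<n. h (X i \<omega>) - d) \<le> b" for n by (auto simp: bdd_above_def)
    have "(\<lambda>n. d + b / real n) \<longlonglongrightarrow> d + 0" by (intro tendsto_intros lim_const_over_n)
    then have "\<forall>\<^sub>F n in sequentially. d + b / real n < c"
      using d(2) by (intro order_tendstoD(2)) auto
    then show ?case
      using eventually_gt_at_top[of 0]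
    proof eventually_elim
      case (elim n)
      have "(\<Sum>i<n. h (X i \<omega>)) / n \<le> d + b / n"
        using b[of n] elim(2) by (simp add: sum_subtractf field_simps)
      then show ?case using elim(1) by linarith
    qed
  qed
qed

theorem strong_law_of_large_numbers:
  fixes X :: "nat \<Rightarrow> 'a \<Rightarrow> 'b" and h :: "'b \<Rightarrow> real"
  assumes iid: "iid_vars N Q X UNIV" and int: "integrable Q h"
  shows "AE \<omega> in M. (\<lambda>n. (\<Sum>i<n. h (X i \<omega>)) / n) \<longlonglongrightarrow> (\<integral>x. h x \<partial>Q)"
proof -
  let ?e = "\<lambda>k. inverse (real (Suc k))"
  have upper: "AE \<omega> in M. \<forall>k. (\<forall>\<^sub>F n in sequentially. (\<Sum>i<n. g (X i \<omega>)) / n < (\<integral>x. g x \<partial>Q) + ?e k)"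
    if "integrable Q g" for g :: "'b \<Rightarrow> real"
    unfolding AE_all_countable by (intro allI AE_eventually_average_less[OF iid that]) simp
  have "integrable Q (\<lambda>x. - h x)" using int by simp
  from upper[OF int] upper[OF this] show ?thesis
  proof eventually_elim
    case (elim \<omega>)
    show ?case
    proof (rule tendstoI)
      fix e :: real assume "0 < e"
      then obtain k where k: "?e k < e" using reals_Archimedean by blast
      show "\<forall>\<^sub>F n in sequentially. dist ((\<Sum>i<n. h (X i \<omega>)) / n) (\<integral>x. h x \<partial>Q) < e"
        using elim[rule_format, of k]
        by eventually_elim (use k in \<open>auto simp: dist_real_def sum_negf abs_less_iff\<close>)
    qed
  qed
qed

end

section \<open>Uniform laws of large numbers\<close>

definition sample_mean :: "(nat \<Rightarrow> 'a \<Rightarrow> 'b) \<Rightarrow> ('b \<Rightarrow> 'c::real_vector) \<Rightarrow> nat \<Rightarrow> 'a \<Rightarrow> 'c" where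
  "sample_mean Z h N \<omega> = (1 / real N) *\<^sub>R (\<Sum>i\<in>{1..N}. h (Z i \<omega>))"

lemma sample_mean_diff:
  "sample_mean Z (\<lambda>x. g x - h x) N \<omega> = sample_mean Z g N \<omega> - sample_mean Z h N \<omega>"
  by (simp add: sample_mean_def sum_subtractf scaleR_diff_right)

lemma norm_sample_mean_le:
  fixes h :: "'b \<Rightarrow> 'c::real_normed_vector"
  assumes "\<And>x. norm (h x) \<le> b x"
  shows "norm (sample_mean Z h N \<omega>) \<le> sample_mean Z b N \<omega>"
  using assms by (simp add: sample_mean_def divide_right_mono sum_norm_le)

lemma blinfun_apply_sample_mean:
  "blinfun_apply (sample_mean Z h N \<omega>) z = sample_mean Z (\<lambda>x. blinfun_apply (h x) z) N \<omega>"
  by (simp add: sample_mean_def blinfun.scaleR_left blinfun.sum_left)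

lemma continuous_on_sample_mean:
  fixes H :: "'k::topological_space \<Rightarrow> 'b \<Rightarrow> 'c::real_normed_vector"
  shows "(\<And>x. continuous_on K (\<lambda>k. H k x)) \<Longrightarrow> continuous_on K (\<lambda>k. sample_mean Z (H k) N \<omega>)"
  unfolding sample_mean_def by (intro continuous_intros)

lemma (in prob_space) strong_law_sample_mean:
  fixes h :: "'b \<Rightarrow> real"
  assumes iid: "iid_vars S Q Z {1..}" and int: "integrable Q h"
  shows "AE \<omega> in M. (\<lambda>N. sample_mean Z h N \<omega>) \<longlonglongrightarrow> (\<integral>x. h x \<partial>Q)"
proof -
  have "iid_vars S Q (\<lambda>i. Z (Suc i)) UNIV" using iid by (rule iid_vars_reindex) auto
  then have "AE \<omega> in M. (\<lambda>N. (\<Sum>i<N. h (Z (Suc i) \<omega>)) / N) \<longlonglongrightarrow> (\<integral>x. h x \<partial>Q)"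
    using int by (rule strong_law_of_large_numbers)
  moreover have "sample_mean Z h N \<omega> = (\<Sum>i<N. h (Z (Suc i) \<omega>)) / N" for N \<omega>
    unfolding sample_mean_def by (simp add: sum.atLeast1_atMost_eq)
  ultimately show ?thesis by simp
qed

lemma AE_uniform_limitI:
  fixes f :: "'a \<Rightarrow> 'n \<Rightarrow> 'k \<Rightarrow> 'c::metric_space"
  assumes "\<And>e. 0 < e \<Longrightarrow> AE \<omega> in M. (\<forall>\<^sub>F n in F. \<forall>k\<in>K. dist (f \<omega> n k) (l k) < e)"
  shows "AE \<omega> in M. uniform_limit K (f \<omega>) l F"
proof -
  have "AE \<omega> in M. \<forall>m. (\<forall>\<^sub>F n in F. \<forall>k\<in>K. dist (f \<omega> n k) (l k) < inverse (real (Suc m)))"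
    unfolding AE_all_countable using assms by simp
  then show ?thesis
  proof eventually_elim
    case (elim \<omega>)
    show ?case
      unfolding uniform_limit_iff
    proof (intro allI impI)
      fix e :: real assume "0 < e"
      then obtain m where m: "inverse (real (Suc m)) < e" using reals_Archimedean by blast
      show "\<forall>\<^sub>F n in F. \<forall>k\<in>K. dist (f \<omega> n k) (l k) < e"
        using elim[rule_format, of m] by eventually_elim (use m in \<open>auto intro: less_trans\<close>)
    qed
  qed
qed

lemma (in prob_space) uniform_law_of_large_numbers_bracketing:
  fixes H :: "'k \<Rightarrow> 'b \<Rightarrow> real"
  assumes iid: "iid_vars S Q Z {1..}" and int_H: "\<And>k. k \<in> K \<Longrightarrow> integrable Q (H k)"
    and bracketing: "\<And>e. 0 < e \<Longrightarrow> \<exists>C g. finite C \<and> C \<subseteq> K \<and>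
      (\<forall>c\<in>C. integrable Q (g c) \<and> (\<integral>x. g c x \<partial>Q) < e) \<and>
      (\<forall>k\<in>K. \<exists>c\<in>C. \<forall>x. \<bar>H k x - H c x\<bar> \<le> g c x)"
  shows "AE \<omega> in M. uniform_limit K (\<lambda>N k. sample_mean Z (H k) N \<omega>) (\<lambda>k. \<integral>x. H k x \<partial>Q) sequentially"
proof (rule AE_uniform_limitI)
  let ?A = "\<lambda>h N \<omega>. sample_mean Z h N \<omega> :: real"
  fix e :: real assume "0 < e"
  then have "0 < e / 3" by simp
  from bracketing[OF this] obtain C g where C: "finite C" "C \<subseteq> K"
    and int_g: "\<And>c. c \<in> C \<Longrightarrow> integrable Q (g c)" and g_small: "\<And>c. c \<in> C \<Longrightarrow> (\<integral>x. g c x \<partial>Q) < e / 3"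
    and near: "\<And>k. k \<in> K \<Longrightarrow> \<exists>c\<in>C. \<forall>x. \<bar>H k x - H c x\<bar> \<le> g c x"
    by metis
  have "AE \<omega> in M. \<forall>c\<in>C. (\<lambda>N. ?A (H c) N \<omega>) \<longlonglongrightarrow> (\<integral>x. H c x \<partial>Q)"
    using C int_H by (intro AE_finite_allI strong_law_sample_mean[OF iid]) auto
  moreover have "AE \<omega> in M. \<forall>c\<in>C. (\<lambda>N. ?A (g c) N \<omega>) \<longlonglongrightarrow> (\<integral>x. g c x \<partial>Q)"
    using C int_g by (intro AE_finite_allI strong_law_sample_mean[OF iid]) auto
  ultimately show "AE \<omega> in M. (\<forall>\<^sub>F N in sequentially. \<forall>k\<in>K. dist (?A (H k) N \<omega>) (\<integral>x. H k x \<partial>Q) < e)"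
  proof eventually_elim
    case (elim \<omega>)
    have "\<forall>\<^sub>F N in sequentially. \<forall>c\<in>C.
        dist (?A (H c) N \<omega>) (\<integral>x. H c x \<partial>Q) < e / 3 \<and> ?A (g c) N \<omega> < e / 3"
      using elim C(1) g_small \<open>0 < e / 3\<close>
      by (intro eventually_ball_finite ballI eventually_conj tendstoD order_tendstoD(2)) auto
    then show ?case
    proof (eventually_elim, intro ballI)
      fix N k assume N: "\<forall>c\<in>C. dist (?A (H c) N \<omega>) (\<integral>x. H c x \<partial>Q) < e / 3 \<and> ?A (g c) N \<omega> < e / 3"
        and k: "k \<in> K"
      obtain c where c: "c \<in> C" "\<And>x. \<bar>H k x - H c x\<bar> \<le> g c x" using near[OF k] by blast
      have int: "integrable Q (H k)" "integrable Q (H c)" using int_H k c(1) C(2) by auto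
      have "\<bar>?A (H k) N \<omega> - ?A (H c) N \<omega>\<bar> \<le> ?A (g c) N \<omega>"
        using norm_sample_mean_le[of "\<lambda>x. H k x - H c x" "g c" Z N \<omega>] c(2)
        by (simp add: sample_mean_diff)
      moreover have "\<bar>\<integral>x. H k x - H c x \<partial>Q\<bar> \<le> (\<integral>x. g c x \<partial>Q)"
        using int int_g[OF c(1)] c(2)
        by (intro order_trans[OF integral_abs_bound integral_mono]) auto
      then have "\<bar>(\<integral>x. H k x \<partial>Q) - (\<integral>x. H c x \<partial>Q)\<bar> \<le> (\<integral>x. g c x \<partial>Q)" using int by simp
      ultimately show "dist (?A (H k) N \<omega>) (\<integral>x. H k x \<partial>Q) < e"
        using N[rule_format, OF c(1)] g_small[OF c(1)] unfolding dist_real_def by linarith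
    qed
  qed
qed

definition oscillation :: "'k set \<Rightarrow> ('k::metric_space \<Rightarrow> 'b::metric_space) \<Rightarrow> 'k \<Rightarrow> real \<Rightarrow> real" where
  "oscillation C h c \<delta> = (SUP k\<in>C \<inter> ball c \<delta>. dist (h k) (h c))"

lemma oscillation_le:
  assumes "c \<in> closure C" "0 < \<delta>" "\<And>k. k \<in> C \<Longrightarrow> dist c k < \<delta> \<Longrightarrow> dist (h k) (h c) \<le> b"
  shows "oscillation C h c \<delta> \<le> b"
  unfolding oscillation_def
proof (rule cSUP_least)
  show "C \<inter> ball c \<delta> \<noteq> {}"
    using assms(1,2) by (fastforce simp: closure_approachable dist_commute)
qed (use assms(3) in auto)

lemma bdd_above_oscillation:
  assumes "compact (closure C)" "continuous_on (closure C) h"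
  shows "bdd_above ((\<lambda>k. dist (h k) (h c)) ` (C \<inter> ball c \<delta>))"
proof -
  have "bounded (h ` closure C)" using assms compact_continuous_image compact_imp_bounded by blast
  then obtain b where "\<And>k. k \<in> closure C \<Longrightarrow> dist (h c) (h k) \<le> b"
    using bounded_any_center[of _ "h c"] by auto
  then show ?thesis
    using closure_subset[of C] by (intro bdd_aboveI2[of _ _ b]) (auto simp: dist_commute)
qed

lemma dist_le_oscillation:
  assumes compact: "compact (closure C)" and cont: "continuous_on (closure C) h"
    and k: "k \<in> closure C" "dist c k < \<delta>"
  shows "dist (h k) (h c) \<le> oscillation C h c \<delta>"
proof (rule continuous_le_on_closure[where f="\<lambda>k. dist (h k) (h c)"])
  have "ball c \<delta> \<inter> closure C \<subseteq> closure (ball c \<delta> \<inter> C)"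
    by (rule open_Int_closure_subset) simp
  then show "k \<in> closure (C \<inter> ball c \<delta>)" using k by (auto simp: Int_commute)
  show "continuous_on (closure (C \<inter> ball c \<delta>)) (\<lambda>k. dist (h k) (h c))"
    by (intro continuous_intros continuous_on_subset[OF cont] closure_mono) auto
  show "dist (h y) (h c) \<le> oscillation C h c \<delta>" if "y \<in> C \<inter> ball c \<delta>" for y
    unfolding oscillation_def using that bdd_above_oscillation[OF compact cont] by (rule cSUP_upper)
qed

lemma oscillation_nonneg:
  assumes "compact (closure C)" "continuous_on (closure C) h" "c \<in> closure C" "0 < \<delta>"
  shows "0 \<le> oscillation C h c \<delta>"
  using dist_le_oscillation[OF assms(1-3), of c \<delta>] assms(4) by simp

lemma tendsto_oscillation:
  assumes compact: "compact (closure C)" and cont: "continuous_on (closure C) h"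
    and c: "c \<in> closure C" and \<delta>: "\<delta> \<longlonglongrightarrow> 0" "\<And>n. 0 < \<delta> n"
  shows "(\<lambda>n. oscillation C h c (\<delta> n)) \<longlonglongrightarrow> 0"
proof (rule tendstoI)
  fix e :: real assume "0 < e"
  then obtain d where d: "0 < d" "\<And>k. k \<in> closure C \<Longrightarrow> dist k c < d \<Longrightarrow> dist (h k) (h c) < e / 2"
    using cont c unfolding continuous_on_iff by (meson half_gt_zero)
  have "\<forall>\<^sub>F n in sequentially. \<delta> n < d" using \<delta>(1) d(1) by (rule order_tendstoD(2))
  then show "\<forall>\<^sub>F n in sequentially. dist (oscillation C h c (\<delta> n)) 0 < e"
  proof eventually_elim
    case (elim n)
    have "oscillation C h c (\<delta> n) \<le> e / 2"
      using c \<delta>(2) elim d(2) closure_subset[of C]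
      by (intro oscillation_le) (auto simp: dist_commute intro!: less_imp_le)
    then show ?case using oscillation_nonneg[OF compact cont c \<delta>(2)] \<open>0 < e\<close> by simp
  qed
qed

lemma borel_measurable_oscillation:
  fixes H :: "'k::metric_space \<Rightarrow> 'b \<Rightarrow> real"
  assumes C: "countable C" "compact (closure C)" and c: "c \<in> closure C"
    and cont: "\<And>x. continuous_on (closure C) (\<lambda>k. H k x)"
    and meas: "\<And>k. k \<in> closure C \<Longrightarrow> H k \<in> borel_measurable Q"
  shows "(\<lambda>x. oscillation C (\<lambda>k. H k x) c \<delta>) \<in> borel_measurable Q"
  unfolding oscillation_def
proof (rule borel_measurable_cSUP)
  show "countable (C \<inter> ball c \<delta>)" using C(1) by blast
  show "(\<lambda>x. dist (H k x) (H c x)) \<in> borel_measurable Q" if "k \<in> C \<inter> ball c \<delta>" for k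
    using that meas c closure_subset[of C] by (intro borel_measurable_dist) auto
  show "bdd_above ((\<lambda>k. dist (H k x) (H c x)) ` (C \<inter> ball c \<delta>))" for x
    using C(2) cont by (rule bdd_above_oscillation)
qed

lemma
  fixes H :: "'k::metric_space \<Rightarrow> 'b \<Rightarrow> real"
  assumes C: "countable C" "compact (closure C)" and c: "c \<in> closure C"
    and cont: "\<And>x. continuous_on (closure C) (\<lambda>k. H k x)"
    and meas: "\<And>k. k \<in> closure C \<Longrightarrow> H k \<in> borel_measurable Q"
    and bound: "\<And>k x. k \<in> closure C \<Longrightarrow> \<bar>H k x\<bar> \<le> \<zeta> x" and int: "integrable Q \<zeta>"
    and \<delta>: "\<delta> \<longlonglongrightarrow> 0" "\<And>n. 0 < \<delta> n"
  shows integrable_oscillation: "integrable Q (\<lambda>x. oscillation C (\<lambda>k. H k x) c (\<delta> n))"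
    and tendsto_integral_oscillation:
      "(\<lambda>n. \<integral>x. oscillation C (\<lambda>k. H k x) c (\<delta> n) \<partial>Q) \<longlonglongrightarrow> 0"
proof -
  let ?osc = "\<lambda>n x. oscillation C (\<lambda>k. H k x) c (\<delta> n)"
  have int_\<zeta>: "integrable Q (\<lambda>x. 2 * \<zeta> x)" using int by simp
  have meas_osc: "?osc n \<in> borel_measurable Q" for n
    by (rule borel_measurable_oscillation[OF C c cont meas])
  have osc_bound: "norm (?osc n x) \<le> 2 * \<zeta> x" for n x
  proof -
    have "dist (H k x) (H c x) \<le> 2 * \<zeta> x" if "k \<in> C" for k
      using bound[OF subsetD[OF closure_subset that], of x] bound[OF c, of x]
      by (simp add: dist_real_def)
    then have "?osc n x \<le> 2 * \<zeta> x" using c \<delta>(2) by (intro oscillation_le)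
    then show ?thesis using oscillation_nonneg[OF C(2) cont c \<delta>(2)] by simp
  qed
  show "integrable Q (?osc n)" for n
    using int_\<zeta> meas_osc order_trans[OF osc_bound abs_ge_self]
    by (intro Bochner_Integration.integrable_bound[OF int_\<zeta>] AE_I2) simp_all
  have "(\<lambda>n. \<integral>x. ?osc n x \<partial>Q) \<longlonglongrightarrow> (\<integral>x. 0 \<partial>Q)"
    by (rule integral_dominated_convergence[OF _ meas_osc int_\<zeta>])
       (simp_all add: osc_bound[unfolded real_norm_def] tendsto_oscillation[OF C(2) cont c \<delta>])
  then show "(\<lambda>n. \<integral>x. ?osc n x \<partial>Q) \<longlonglongrightarrow> 0" by simp
qed

text \<open>Only a countable dense set of parameters enters the oscillation, which makes it measurable;
  its mean tends to zero with the radius, and a finite subcover yields the brackets.\<close>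

theorem (in prob_space) uniform_law_of_large_numbers:
  fixes H :: "'k::{metric_space, second_countable_topology} \<Rightarrow> 'b \<Rightarrow> real"
  assumes iid: "iid_vars S Q Z {1..}" and K: "compact K"
    and cont: "\<And>x. continuous_on K (\<lambda>k. H k x)"
    and meas: "\<And>k. k \<in> K \<Longrightarrow> H k \<in> borel_measurable Q"
    and bound: "\<And>k x. k \<in> K \<Longrightarrow> \<bar>H k x\<bar> \<le> \<zeta> x" and int: "integrable Q \<zeta>"
  shows "AE \<omega> in M. uniform_limit K (\<lambda>N k. sample_mean Z (H k) N \<omega>) (\<lambda>k. \<integral>x. H k x \<partial>Q) sequentially"
proof (rule uniform_law_of_large_numbers_bracketing[OF iid])
  show "integrable Q (H k)" if "k \<in> K" for k
    using int meas[OF that] by (rule Bochner_Integration.integrable_bound)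
      (use bound[OF that] in \<open>auto intro: order_trans[OF _ abs_ge_self]\<close>)
  fix e :: real assume "0 < e"
  obtain C where C: "countable C" "C \<subseteq> K" "K \<subseteq> closure C" by (rule separable)
  then have K_eq: "K = closure C"
    using closure_minimal[OF C(2) compact_imp_closed[OF K]] by blast
  let ?r = "\<lambda>n. inverse (real (Suc n))"
  let ?osc = "\<lambda>n c x. oscillation C (\<lambda>k. H k x) c (?r n)"
  note oscillation_assms = K[unfolded K_eq] _ cont[unfolded K_eq] meas[unfolded K_eq]
    bound[unfolded K_eq] int LIMSEQ_inverse_real_of_nat
  have int_osc: "integrable Q (?osc n c)" if "c \<in> K" for c n
    using that K_eq by (intro integrable_oscillation[OF C(1) oscillation_assms]) auto
  have "\<exists>n. (\<integral>x. ?osc n c x \<partial>Q) < e" if "c \<in> K" for c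
  proof -
    have "(\<lambda>n. \<integral>x. ?osc n c x \<partial>Q) \<longlonglongrightarrow> 0"
      using that K_eq by (intro tendsto_integral_oscillation[OF C(1) oscillation_assms]) auto
    from order_tendstoD(2)[OF this \<open>0 < e\<close>] show ?thesis
      using eventually_happens' trivial_limit_sequentially by blast
  qed
  then obtain n where n: "\<And>c. c \<in> K \<Longrightarrow> (\<integral>x. ?osc (n c) c x \<partial>Q) < e" by metis
  obtain F where F: "F \<subseteq> K" "finite F" "K \<subseteq> (\<Union>c\<in>F. ball c (?r (n c)))"
  proof (rule compactE_image[OF K])
    show "K \<subseteq> (\<Union>c\<in>K. ball c (?r (n c)))" by force
  qed auto
  have "\<bar>H k x - H c x\<bar> \<le> ?osc (n c) c x" if "k \<in> K" "k \<in> ball c (?r (n c))" for k c x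
    using dist_le_oscillation[OF K[unfolded K_eq] cont[unfolded K_eq], of k c "?r (n c)"] that K_eq
    by (simp add: dist_real_def)
  then have "\<forall>k\<in>K. \<exists>c\<in>F. \<forall>x. \<bar>H k x - H c x\<bar> \<le> ?osc (n c) c x" using F(3) by blast
  then show "\<exists>F g. finite F \<and> F \<subseteq> K \<and> (\<forall>c\<in>F. integrable Q (g c) \<and> (\<integral>x. g c x \<partial>Q) < e) \<and>
      (\<forall>k\<in>K. \<exists>c\<in>F. \<forall>x. \<bar>H k x - H c x\<bar> \<le> g c x)"
    using F(1,2) int_osc n by (intro exI[of _ F] exI[of _ "\<lambda>c. ?osc (n c) c"]) auto
qed

section \<open>Weak convergence in Hilbert spaces\<close>

lemma parallelogram_law:
  fixes a b :: "'a::real_inner"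
  shows "(norm (a + b))\<^sup>2 + (norm (a - b))\<^sup>2 = 2 * (norm a)\<^sup>2 + 2 * (norm b)\<^sup>2"
  by (simp add: power2_norm_eq_inner inner_commute algebra_simps)

lemma convex_almost_minimal_norm_dist:
  fixes a b :: "'a::real_inner"
  assumes S: "convex S" "a \<in> S" "b \<in> S" and norm: "norm a \<le> r" "norm b \<le> r"
  shows "(dist a b)\<^sup>2 \<le> 4 * (r\<^sup>2 - (infdist 0 S)\<^sup>2)"
proof -
  let ?m = "midpoint a b"
  have "infdist 0 S \<le> norm ?m"
    using infdist_le[of ?m S 0]
      subsetD[OF closed_segment_subset[OF S(2,3,1)] midpoint_in_closed_segment]
    by simp
  then have "(infdist 0 S)\<^sup>2 \<le> (norm ?m)\<^sup>2" by (intro power_mono infdist_nonneg)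
  moreover have "(norm a)\<^sup>2 \<le> r\<^sup>2" "(norm b)\<^sup>2 \<le> r\<^sup>2" using norm by (auto intro: power_mono)
  moreover have "(norm (a + b))\<^sup>2 = 4 * (norm ?m)\<^sup>2"
    by (simp add: midpoint_def power_divide)
  ultimately show ?thesis using parallelogram_law[of a b] by (simp add: dist_norm)
qed

lemma decseq_infdist_convergent:
  fixes C :: "nat \<Rightarrow> 'a::metric_space set"
  assumes dec: "decseq C" and nonempty: "\<And>n. C n \<noteq> {}" and bounded: "bounded (C 0)"
  obtains L where "(\<lambda>n. infdist a (C n)) \<longlonglongrightarrow> L" "\<And>n. infdist a (C n) \<le> L"
proof -
  obtain R where R: "\<And>x. x \<in> C 0 \<Longrightarrow> dist a x \<le> R" using bounded bounded_any_center[of _ a] by auto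
  have "infdist a (C n) \<le> R" for n
  proof -
    obtain x where x: "x \<in> C n" using nonempty by blast
    then have "x \<in> C 0" using decseqD[OF dec, of 0 n] by blast
    then show ?thesis using R infdist_le2[OF x] by blast
  qed
  moreover have "incseq (\<lambda>n. infdist a (C n))"
    unfolding incseq_def using dec nonempty by (auto simp: decseq_def intro!: infdist_mono)
  ultimately show ?thesis using that incseq_convergent by metis
qed

lemma convex_almost_minimal_norm_diameter:
  fixes C :: "nat \<Rightarrow> 'a::real_inner set"
  assumes convex: "\<And>n. convex (C n)" and L: "(\<lambda>n. infdist 0 (C n)) \<longlonglongrightarrow> L" and r: "r \<longlonglongrightarrow> L" and e: "0 < e"
  shows "\<exists>n. \<forall>x\<in>C n \<inter> cball 0 (r n). \<forall>y\<in>C n \<inter> cball 0 (r n). dist x y < e"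
proof -
  let ?d = "\<lambda>n. 4 * ((r n)\<^sup>2 - (infdist 0 (C n))\<^sup>2)"
  have "?d \<longlonglongrightarrow> 4 * (L\<^sup>2 - L\<^sup>2)" by (intro tendsto_intros L r)
  then have "\<forall>\<^sub>F n in sequentially. ?d n < e\<^sup>2" using e by (intro order_tendstoD(2)) auto
  then obtain n where n: "?d n < e\<^sup>2" using eventually_happens' trivial_limit_sequentially by blast
  have "dist x y < e" if "x \<in> C n \<inter> cball 0 (r n)" "y \<in> C n \<inter> cball 0 (r n)" for x y
  proof -
    have "(dist x y)\<^sup>2 \<le> ?d n" using that by (intro convex_almost_minimal_norm_dist convex) auto
    also note n
    finally show ?thesis using e by (auto intro: power_less_imp_less_base)
  qed
  then show ?thesis by blast
qed

text \<open>Intersecting the sets with balls whose radii decrease to the supremum of their distances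
  from the origin makes the diameters vanish.\<close>

lemma decseq_closed_convex_bounded_Inter_nonempty:
  fixes C :: "nat \<Rightarrow> 'a::{real_inner, complete_space} set"
  assumes closed: "\<And>n. closed (C n)" and convex: "\<And>n. convex (C n)" and nonempty: "\<And>n. C n \<noteq> {}"
    and dec: "decseq C" and bounded: "bounded (C 0)"
  shows "(\<Inter>n. C n) \<noteq> {}"
proof -
  let ?q = "\<lambda>n. infdist 0 (C n)" and ?e = "\<lambda>n. inverse (real (Suc n))"
  obtain L where L: "?q \<longlonglongrightarrow> L" and q_le: "\<And>n. ?q n \<le> L"
    using decseq_infdist_convergent[OF dec nonempty bounded] by blast
  let ?S = "\<lambda>n. C n \<inter> cball 0 (L + ?e n)"
  have small: "\<exists>n. \<forall>x\<in>?S n. \<forall>y\<in>?S n. dist x y < e" if "0 < e" for e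
    using convex_almost_minimal_norm_diameter[OF convex L LIMSEQ_inverse_real_of_nat_add that] .
  have nonempty_S: "?S n \<noteq> {}" for n
  proof -
    have "?q n < L + ?e n" using q_le[of n] by (rule le_less_trans) simp
    then have "(INF x\<in>C n. dist 0 x) < L + ?e n" by (simp only: infdist_notempty[OF nonempty])
    moreover have "bdd_below (dist 0 ` C n)" by (rule bdd_belowI2[of _ 0]) simp
    ultimately obtain x where "x \<in> C n" "dist 0 x < L + ?e n"
      using cINF_less_iff[OF nonempty] by blast
    then show ?thesis by auto
  qed
  have dec_S: "?S n \<subseteq> ?S m" if "m \<le> n" for m n
  proof -
    have "?e n \<le> ?e m" using that by (intro le_imp_inverse_le) auto
    then have "cball 0 (L + ?e n) \<subseteq> cball (0::'a) (L + ?e m)" by (intro subset_cball) simp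
    then show ?thesis using decseqD[OF dec that] by blast
  qed
  have "closed (?S n)" for n using closed by (intro closed_Int closed_cball)
  then obtain a where "\<And>n. a \<in> ?S n"
    using decreasing_closed_nest[of ?S, OF _ nonempty_S dec_S small] by blast
  then show ?thesis by blast
qed

lemma inner_closure_convex_hull_dist:
  fixes x :: "'i \<Rightarrow> 'a::real_inner"
  assumes near: "\<And>i. i \<in> I \<Longrightarrow> dist (inner (x i) v) l \<le> e" and u: "u \<in> closure (convex hull (x ` I))"
  shows "dist (inner u v) l \<le> e"
proof -
  have "bounded_linear (\<lambda>y. inner y v)" by (rule bounded_linear_inner_left)
  then have "closed ((\<lambda>y. inner y v) -` cball l e)" "convex ((\<lambda>y. inner y v) -` cball l e)"
    by (auto intro!: closed_vimage linear_continuous_on convex_linear_vimage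
        simp: bounded_linear.linear)
  moreover have "x ` I \<subseteq> (\<lambda>y. inner y v) -` cball l e" using near by (auto simp: dist_commute)
  ultimately have "closure (convex hull (x ` I)) \<subseteq> (\<lambda>y. inner y v) -` cball l e"
    by (intro closure_minimal hull_minimal)
  then show ?thesis using u by (auto simp: dist_commute)
qed

text \<open>A single construction yields the Riesz representative of the limit functional and Mazur's
  lemma: the weak limit is the point common to the closed convex hulls of all tails.\<close>

lemma weak_limit_in_convex_hull_tails:
  fixes x :: "nat \<Rightarrow> 'a::{real_inner, complete_space}"
  assumes bounded: "bounded (range x)" and lim: "\<And>v. (\<lambda>n. inner (x n) v) \<longlonglongrightarrow> l v"
  obtains u where "weakly_converges x u" "\<And>n. u \<in> closure (convex hull (x ` {n..}))"
proof -
  let ?C = "\<lambda>n. closure (convex hull (x ` {n..}))"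
  have "(\<Inter>n. ?C n) \<noteq> {}"
  proof (rule decseq_closed_convex_bounded_Inter_nonempty)
    show "decseq ?C" unfolding decseq_def by (intro allI impI closure_mono hull_mono image_mono) auto
    show "bounded (?C 0)"
      using bounded by (intro bounded_closure bounded_convex_hull) (auto simp: atLeast_0)
  qed (auto intro: convex_closure convex_convex_hull)
  then obtain u where u: "\<And>n. u \<in> ?C n" by blast
  have "inner u v = l v" for v
  proof -
    have "dist (inner u v) (l v) \<le> e" if e: "0 < e" for e
    proof -
      obtain n where "\<And>m. n \<le> m \<Longrightarrow> dist (inner (x m) v) (l v) < e"
        using tendstoD[OF lim[of v] e] by (auto simp: eventually_sequentially)
      then show ?thesis
        by (intro inner_closure_convex_hull_dist[OF _ u[of n]]) (auto intro: less_imp_le)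
    qed
    then show ?thesis by (meson dense_ge dist_le_zero_iff)
  qed
  then have "weakly_converges x u" using lim by (simp add: weakly_converges_def)
  then show ?thesis using u by (rule that)
qed

lemma weakly_converges_unique:
  assumes "weakly_converges x u" "weakly_converges x v"
  shows "u = v"
proof -
  have "inner u w = inner v w" for w
    using assms LIMSEQ_unique unfolding weakly_converges_def by blast
  then have "inner (u - v) (u - v) = 0" by (simp add: inner_diff_left)
  then show ?thesis by simp
qed

lemma weakly_converges_subseq:
  assumes "weakly_converges x u" "strict_mono r"
  shows "weakly_converges (x \<circ> r) u"
  using assms LIMSEQ_subseq_LIMSEQ unfolding weakly_converges_def by (fastforce simp: comp_def)

lemma weak_limit_in_closed_convex:
  fixes x :: "nat \<Rightarrow> 'a::{real_inner, complete_space}"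
  assumes bounded: "bounded (range x)" and weak: "weakly_converges x u"
    and S: "closed S" "convex S" "\<forall>\<^sub>F n in sequentially. x n \<in> S"
  shows "u \<in> S"
proof -
  have "\<And>v. (\<lambda>n. inner (x n) v) \<longlonglongrightarrow> inner u v" using weak by (simp add: weakly_converges_def)
  from weak_limit_in_convex_hull_tails[OF bounded this] obtain u'
    where u': "weakly_converges x u'" "\<And>n. u' \<in> closure (convex hull (x ` {n..}))" by blast
  obtain n where "\<And>m. n \<le> m \<Longrightarrow> x m \<in> S" using S(3) by (auto simp: eventually_sequentially)
  then have "closure (convex hull (x ` {n..})) \<subseteq> S"
    using S(1,2) by (intro closure_minimal hull_minimal) auto
  then show ?thesis using u'(2) weakly_converges_unique[OF weak u'(1)] by blast
qed

lemma convergent_inner_closure: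
  fixes x :: "nat \<Rightarrow> 'a::real_inner"
  assumes bounded: "bounded (range x)" and v: "v \<in> closure D"
    and conv: "\<And>d. d \<in> D \<Longrightarrow> convergent (\<lambda>n. inner (x n) d)"
  shows "convergent (\<lambda>n. inner (x n) v)"
proof -
  obtain R where R: "\<And>n. norm (x n) \<le> R" "0 < R" using bounded by (auto simp: bounded_pos)
  have "Cauchy (\<lambda>n. inner (x n) v)"
  proof (rule metric_CauchyI)
    fix e :: real assume "0 < e"
    then have "0 < e / 3" "0 < e / (3 * R)" using R(2) by auto
    then obtain d where d: "d \<in> D" "dist d v < e / (3 * R)" using v closure_approachable by blast
    have near: "\<bar>inner (x n) v - inner (x n) d\<bar> < e / 3" for n
    proof -
      have "\<bar>inner (x n) v - inner (x n) d\<bar> \<le> norm (x n) * dist d v"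
        using Cauchy_Schwarz_ineq2[of "x n" "v - d"]
        by (simp add: inner_diff_right dist_norm norm_minus_commute)
      also have "\<dots> \<le> R * dist d v" using R(1) by (intro mult_right_mono) auto
      also have "\<dots> < e / 3" using d(2) R(2) by (simp add: field_simps)
      finally show ?thesis .
    qed
    obtain N where N: "\<And>m n. N \<le> m \<Longrightarrow> N \<le> n \<Longrightarrow> dist (inner (x m) d) (inner (x n) d) < e / 3"
      using metric_CauchyD[OF convergent_Cauchy[OF conv[OF d(1)]] \<open>0 < e / 3\<close>] by blast
    have "dist (inner (x m) v) (inner (x n) v) < e" if "N \<le> m" "N \<le> n" for m n
      using N[OF that] near[of m] near[of n] unfolding dist_real_def by linarith
    then show "\<exists>N. \<forall>m\<ge>N. \<forall>n\<ge>N. dist (inner (x m) v) (inner (x n) v) < e" by blast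
  qed
  then show ?thesis by (simp add: Cauchy_convergent_iff)
qed

lemma bounded_imp_weakly_convergent_subseq:
  fixes x :: "nat \<Rightarrow> 'a::{real_inner, complete_space, second_countable_topology}"
  assumes bounded: "bounded (range x)"
  obtains r u where "strict_mono r" "weakly_converges (x \<circ> r) u"
proof -
  obtain R where R: "\<And>n. norm (x n) \<le> R" using bounded by (auto simp: bounded_iff)
  obtain D :: "'a set" where D: "countable D" "UNIV \<subseteq> closure D" using separable[of UNIV] by metis
  have "norm (inner (x n) (sgn d)) \<le> R" for n d
  proof -
    have "norm (inner (x n) (sgn d)) \<le> norm (x n) * norm (sgn d)" by (simp add: Cauchy_Schwarz_ineq2)
    also have "\<dots> \<le> norm (x n)" by (simp add: norm_sgn)
    finally show ?thesis using R[of n] by linarith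
  qed
  then obtain r where r: "strict_mono r"
    and lim: "\<And>d. d \<in> D \<Longrightarrow> \<exists>l. (\<lambda>n. inner (x (r n)) (sgn d)) \<longlonglongrightarrow> l"
    using function_convergent_subsequence[OF D(1), of "\<lambda>n d. inner (x n) (sgn d)" R] by metis
  have bounded_r: "bounded (range (x \<circ> r))" using bounded by (rule bounded_subset) auto
  have "convergent (\<lambda>n. inner ((x \<circ> r) n) d)" if d: "d \<in> D" for d
  proof -
    obtain l where "(\<lambda>n. inner (x (r n)) (sgn d)) \<longlonglongrightarrow> l" using lim[OF d] by blast
    then have "(\<lambda>n. norm d * inner (x (r n)) (sgn d)) \<longlonglongrightarrow> norm d * l" by (intro tendsto_intros)
    moreover have "norm d * inner y (sgn d) = inner y d" for y
      by (cases "d = 0") (simp_all add: sgn_div_norm)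
    ultimately show ?thesis by (auto simp: convergent_def)
  qed
  then have "convergent (\<lambda>n. inner ((x \<circ> r) n) v)" for v
    using D(2) by (intro convergent_inner_closure[OF bounded_r, of v D]) auto
  then have "\<And>v. (\<lambda>n. inner ((x \<circ> r) n) v) \<longlonglongrightarrow> lim (\<lambda>n. inner ((x \<circ> r) n) v)"
    by (simp add: convergent_LIMSEQ_iff)
  from weak_limit_in_convex_hull_tails[OF bounded_r this] r that show thesis by blast
qed

lemma eventually_bounded_imp_bounded_range:
  fixes x :: "nat \<Rightarrow> 'a::real_normed_vector"
  assumes "\<forall>\<^sub>F n in sequentially. x n \<in> S" "bounded S"
  shows "bounded (range x)"
proof -
  obtain R where R: "\<And>u. u \<in> S \<Longrightarrow> norm u \<le> R" using assms(2) by (auto simp: bounded_iff)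
  have "\<forall>\<^sub>F n in sequentially. norm (x n) \<le> R" using assms(1) by eventually_elim (rule R)
  then have "Bfun x sequentially" by (rule BfunI)
  then show ?thesis by (simp add: Bseq_eq_bounded)
qed

lemma eventually_bounded_imp_weak_accumulation_point:
  fixes x :: "nat \<Rightarrow> 'a::{real_inner, complete_space, second_countable_topology}"
  assumes "\<forall>\<^sub>F n in sequentially. x n \<in> S" "bounded S"
  shows "\<exists>u. weak_accumulation_point x u"
  using bounded_imp_weakly_convergent_subseq[OF eventually_bounded_imp_bounded_range[OF assms]]
  unfolding weak_accumulation_point_def by metis

section \<open>Compact operators\<close>

lemma compact_operator_compact_closure_image:
  assumes B: "compact_operator B" and S: "bounded S"
  shows "compact (closure (B ` S))"
proof -
  interpret bounded_linear B using B by (simp add: compact_operator_def)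
  let ?Z = "closure (B ` cball 0 1)"
  obtain R where R: "\<And>u. u \<in> S \<Longrightarrow> norm u \<le> R" "0 < R" using S by (auto simp: bounded_pos)
  have Z: "compact ((*\<^sub>R) R ` ?Z)" using B by (intro compact_scaling) (simp add: compact_operator_def)
  have "B u \<in> (*\<^sub>R) R ` ?Z" if "u \<in> S" for u
  proof
    show "B u = R *\<^sub>R B (u /\<^sub>R R)" using R(2) by (simp add: scaleR)
    show "B (u /\<^sub>R R) \<in> ?Z"
      using R that by (intro subsetD[OF closure_subset] imageI) (simp add: field_simps)
  qed
  then have "closure (B ` S) \<subseteq> (*\<^sub>R) R ` ?Z" using Z by (intro closure_minimal compact_imp_closed) auto
  then show ?thesis using Z closed_Int_compact[OF closed_closure] by (metis inf.absorb1)
qed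

text \<open>Mazur's lemma replaces Hahn--Banach: the weak limit lies in every closed convex set
  \<open>B -` cball l e\<close>, because the sequence eventually does.\<close>

lemma bounded_linear_weak_strong_limit_eq:
  fixes B :: "'a::{real_inner, complete_space} \<Rightarrow> 'b::real_normed_vector"
  assumes B: "bounded_linear B" and x: "bounded (range x)" "weakly_converges x u"
    and lim: "(\<lambda>n. B (x n)) \<longlonglongrightarrow> l"
  shows "l = B u"
proof -
  have "dist l (B u) \<le> e" if "0 < e" for e
  proof -
    have "closed (B -` cball l e)"
      using B by (intro closed_vimage closed_cball linear_continuous_on)
    moreover have "convex (B -` cball l e)"
      using B by (intro convex_linear_vimage convex_cball bounded_linear.linear)
    moreover have "\<forall>\<^sub>F n in sequentially. x n \<in> B -` cball l e"
      using tendstoD[OF lim that] by eventually_elim (simp add: dist_commute)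
    ultimately have "u \<in> B -` cball l e" by (rule weak_limit_in_closed_convex[OF x])
    then show ?thesis by simp
  qed
  then show ?thesis by (meson dense_ge dist_le_zero_iff)
qed

lemma compact_operator_image_compact:
  fixes B :: "'a::{real_inner, complete_space, second_countable_topology} \<Rightarrow> 'b::real_normed_vector"
  assumes B: "compact_operator B" and S: "closed S" "convex S" "bounded S"
  shows "compact (B ` S)"
proof -
  have "closed (B ` S)"
    unfolding closed_sequential_limits
  proof (intro allI impI, elim conjE)
    fix y l assume "\<forall>n. y n \<in> B ` S" and lim: "y \<longlonglongrightarrow> l"
    then have "\<forall>n. \<exists>x. x \<in> S \<and> y n = B x" by auto
    then obtain x where x: "\<And>n. x n \<in> S" "\<And>n. y n = B (x n)" by metis
    have bounded: "bounded (range (x \<circ> r))" for r :: "nat \<Rightarrow> nat"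
      using S(3) by (rule bounded_subset) (use x in auto)
    then obtain r u where r: "strict_mono r" and weak: "weakly_converges (x \<circ> r) u"
      using bounded_imp_weakly_convergent_subseq[of x] bounded[of id] by auto
    have "u \<in> S" using weak_limit_in_closed_convex[OF bounded weak S(1,2)] x(1) by simp
    moreover have "(\<lambda>n. B ((x \<circ> r) n)) \<longlonglongrightarrow> l"
      using LIMSEQ_subseq_LIMSEQ[OF lim r] x(2) by (simp add: comp_def)
    then have "l = B u"
      using B by (intro bounded_linear_weak_strong_limit_eq[OF _ bounded weak])
        (simp_all add: compact_operator_def)
    ultimately show "l \<in> B ` S" by blast
  qed
  then show ?thesis using compact_operator_compact_closure_image[OF B S(3)] by simp
qed

lemma LIMSEQ_subsubseq:
  fixes X :: "nat \<Rightarrow> 'a::topological_space"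
  assumes "\<And>s :: nat \<Rightarrow> nat. strict_mono s \<Longrightarrow> \<exists>r. strict_mono r \<and> (\<lambda>n. X (s (r n))) \<longlonglongrightarrow> L"
  shows "X \<longlonglongrightarrow> L"
proof (rule ccontr)
  assume "\<not> X \<longlonglongrightarrow> L"
  then obtain S where S: "open S" "L \<in> S" "\<not> (\<forall>\<^sub>F n in sequentially. X n \<in> S)"
    unfolding tendsto_def by blast
  then have infinite: "infinite {n. X n \<notin> S}"
    by (simp add: cofinite_eq_sequentially[symmetric] eventually_cofinite)
  let ?s = "enumerate {n. X n \<notin> S}"
  have "strict_mono ?s" using infinite by (auto intro: strict_monoI enumerate_mono)
  obtain r where "(\<lambda>n. X (?s (r n))) \<longlonglongrightarrow> L"
    using assms[of ?s] \<open>strict_mono ?s\<close> by blast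
  then have "\<forall>\<^sub>F n in sequentially. X (?s (r n)) \<in> S" using S(1,2) by (rule topological_tendstoD)
  then show False using enumerate_in_set[OF infinite] by simp
qed

lemma compact_operator_weak_to_strong:
  fixes B :: "'a::{real_inner, complete_space} \<Rightarrow> 'b::real_normed_vector"
  assumes B: "compact_operator B" and bounded: "bounded (range x)" and weak: "weakly_converges x u"
  shows "(\<lambda>n. B (x n)) \<longlonglongrightarrow> B u"
proof (rule LIMSEQ_subsubseq)
  fix s :: "nat \<Rightarrow> nat" assume s: "strict_mono s"
  have "compact (closure (B ` range x))"
    using B bounded by (rule compact_operator_compact_closure_image)
  moreover have "B (x (s n)) \<in> closure (B ` range x)" for n
    by (intro subsetD[OF closure_subset]) auto
  ultimately obtain l r where r: "strict_mono r" and lim: "((\<lambda>n. B (x (s n))) \<circ> r) \<longlonglongrightarrow> l"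
    using compact_imp_seq_compact seq_compactE by metis
  have "bounded (range (x \<circ> (s \<circ> r)))" using bounded by (rule bounded_subset) auto
  moreover have "weakly_converges (x \<circ> (s \<circ> r)) u"
    using weak s r by (intro weakly_converges_subseq strict_mono_o)
  ultimately have "l = B u"
    using B lim by (intro bounded_linear_weak_strong_limit_eq)
      (simp_all add: compact_operator_def comp_def)
  then show "\<exists>r. strict_mono r \<and> (\<lambda>n. B (x (s (r n)))) \<longlonglongrightarrow> B u"
    using r lim by (auto simp: comp_def)
qed

section \<open>Gap functionals\<close>

definition sublevel :: "('u \<Rightarrow> ereal) \<Rightarrow> real \<Rightarrow> 'u set" where
  "sublevel \<psi> t = {u. \<psi> u \<le> ereal t}"

lemma in_sublevel_imp_dom: "u \<in> sublevel \<psi> t \<Longrightarrow> u \<in> dom_fun \<psi>"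
  by (auto simp: sublevel_def dom_fun_def)

lemma in_sublevel_iff:
  assumes "proper_fun \<psi>" "u \<in> dom_fun \<psi>"
  shows "u \<in> sublevel \<psi> t \<longleftrightarrow> real_of_ereal (\<psi> u) \<le> t"
  using assms by (cases "\<psi> u") (auto simp: sublevel_def proper_fun_def dom_fun_def)

lemma closed_sublevel:
  assumes "closed_fun \<psi>"
  shows "closed (sublevel \<psi> t)"
proof -
  have "closed ((\<lambda>u. (u, t)) -` {(u, t::real). \<psi> u \<le> ereal t})"
    using assms unfolding closed_fun_def by (intro closed_vimage continuous_intros) auto
  then show ?thesis by (simp add: vimage_def sublevel_def)
qed

lemma convex_sublevel:
  assumes "convex_fun \<psi>"
  shows "convex (sublevel \<psi> t)"
proof (rule convexI)
  fix a b and p q :: real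
  assume ab: "a \<in> sublevel \<psi> t" "b \<in> sublevel \<psi> t" and pq: "0 \<le> p" "0 \<le> q" "p + q = 1"
  have "p *\<^sub>R (a, t) + q *\<^sub>R (b, t) \<in> {(u, t::real). \<psi> u \<le> ereal t}"
    using assms ab pq unfolding convex_fun_def by (intro convexD) (auto simp: sublevel_def)
  moreover have "p * t + q * t = t" using pq(3) by (metis distrib_right mult_1)
  ultimately show "p *\<^sub>R a + q *\<^sub>R b \<in> sublevel \<psi> t" by (simp add: sublevel_def)
qed

definition eventually_gap_le ::
    "('u::real_inner \<Rightarrow> ereal) \<Rightarrow> (nat \<Rightarrow> 'u \<Rightarrow> 'u) \<Rightarrow> (nat \<Rightarrow> real) \<Rightarrow> (nat \<Rightarrow> 'u) \<Rightarrow> bool" where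
  "eventually_gap_le \<psi> d \<epsilon> x \<longleftrightarrow>
    (\<forall>\<^sub>F n in sequentially. x n \<in> dom_fun \<psi> \<and> gap \<psi> (d n (x n)) (x n) \<le> ereal (\<epsilon> n))"

lemma gap_upper:
  "v \<in> dom_fun \<psi> \<Longrightarrow> ereal (inner d (u - v) + real_of_ereal (\<psi> u) - real_of_ereal (\<psi> v)) \<le> gap \<psi> d u"
  unfolding gap_def by (rule SUP_upper)

lemma gap_nonneg: "u \<in> dom_fun \<psi> \<Longrightarrow> 0 \<le> gap \<psi> d u"
  using gap_upper[of u \<psi> d u] by (simp add: zero_ereal_def)

lemma gap_le_add:
  assumes "gap \<psi> d u \<le> ereal \<epsilon>"
    and "\<And>v. v \<in> dom_fun \<psi> \<Longrightarrow> inner d' (u - v) \<le> inner d (u - v) + \<eta>"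
  shows "gap \<psi> d' u \<le> ereal (\<epsilon> + \<eta>)"
  unfolding gap_def
proof (rule SUP_least)
  fix v assume v: "v \<in> dom_fun \<psi>"
  have "ereal (inner d (u - v) + real_of_ereal (\<psi> u) - real_of_ereal (\<psi> v)) \<le> ereal \<epsilon>"
    using gap_upper[OF v] assms(1) by (rule order_trans)
  then show "ereal (inner d' (u - v) + real_of_ereal (\<psi> u) - real_of_ereal (\<psi> v)) \<le> ereal (\<epsilon> + \<eta>)"
    using assms(2)[OF v] by simp
qed

lemma gap_le_imp_sublevel:
  assumes "proper_fun \<psi>" "u \<in> dom_fun \<psi>" "v \<in> dom_fun \<psi>"
    and gap: "gap \<psi> d u \<le> ereal \<epsilon>" and "inner d (v - u) \<le> c"
  shows "u \<in> sublevel \<psi> (real_of_ereal (\<psi> v) + c + \<epsilon>)"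
proof -
  have "ereal (inner d (u - v) + real_of_ereal (\<psi> u) - real_of_ereal (\<psi> v)) \<le> ereal \<epsilon>"
    using gap_upper[OF \<open>v \<in> dom_fun \<psi>\<close>] gap by (rule order_trans)
  then show ?thesis using assms by (simp add: in_sublevel_iff inner_diff_right)
qed

lemma gap_zero_of_weak_limit:
  fixes u :: "'u::{real_inner, complete_space}"
  assumes \<psi>: "proper_fun \<psi>" "closed_fun \<psi>" "convex_fun \<psi>"
    and x: "bounded (range x)" "weakly_converges x u"
    and dom: "\<forall>\<^sub>F n in sequentially. x n \<in> dom_fun \<psi>"
    and lim: "\<And>v. v \<in> dom_fun \<psi> \<Longrightarrow> (\<lambda>n. inner (d n) (x n - v)) \<longlonglongrightarrow> inner d' (u - v)"
    and gap: "(\<lambda>n. gap \<psi> (d n) (x n)) \<longlonglongrightarrow> 0"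
  shows "u \<in> dom_fun \<psi> \<and> gap \<psi> d' u = 0"
proof -
  let ?p = "\<lambda>u. real_of_ereal (\<psi> u)"
  have sublevel: "u \<in> sublevel \<psi> (?p v - inner d' (u - v) + e)"
    if v: "v \<in> dom_fun \<psi>" and "0 < e" for v e
  proof (rule weak_limit_in_closed_convex[OF x])
    have "\<forall>\<^sub>F n in sequentially. gap \<psi> (d n) (x n) < ereal (e / 2)"
      using gap \<open>0 < e\<close> by (intro order_tendstoD(2)) auto
    moreover have "\<forall>\<^sub>F n in sequentially. inner d' (u - v) - e / 2 < inner (d n) (x n - v)"
      using lim[OF v] \<open>0 < e\<close> by (intro order_tendstoD(1)) auto
    ultimately show "\<forall>\<^sub>F n in sequentially. x n \<in> sublevel \<psi> (?p v - inner d' (u - v) + e)"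
      using dom
    proof eventually_elim
      case (elim n)
      then have "x n \<in> sublevel \<psi> (?p v + (e / 2 - inner d' (u - v)) + e / 2)"
        using \<psi>(1) v by (intro gap_le_imp_sublevel[where d="d n"]) (auto simp: inner_diff_right)
      then show ?case by (simp add: algebra_simps)
    qed
  qed (use \<psi> in \<open>auto intro: closed_sublevel convex_sublevel\<close>)
  obtain v\<^sub>0 where "v\<^sub>0 \<in> dom_fun \<psi>" using \<psi>(1) by (auto simp: proper_fun_def)
  from sublevel[OF this zero_less_one] have u: "u \<in> dom_fun \<psi>" by (rule in_sublevel_imp_dom)
  have "gap \<psi> d' u \<le> 0"
    unfolding gap_def
  proof (rule SUP_least)
    fix v assume v: "v \<in> dom_fun \<psi>"
    have "?p u \<le> ?p v - inner d' (u - v) + e" if "0 < e" for e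
      using sublevel[OF v that] by (simp add: in_sublevel_iff[OF \<psi>(1) u])
    then have "?p u \<le> ?p v - inner d' (u - v)" by (rule field_le_epsilon)
    then show "ereal (inner d' (u - v) + ?p u - ?p v) \<le> 0" by simp
  qed
  then show ?thesis using u gap_nonneg[OF u, of d'] by (auto intro: antisym)
qed

section \<open>Weak-star expectations\<close>

lemma borel_measurable_blinfun_apply:
  fixes G :: "'a \<Rightarrow> ('w::real_normed_vector \<Rightarrow>\<^sub>L real)"
  assumes "G \<in> borel_measurable M"
  shows "(\<lambda>x. G x z) \<in> borel_measurable M"
  using borel_measurable_continuous_onI[OF linear_continuous_on[OF blinfun.bounded_linear_left]]
  by (rule measurable_compose[OF assms])

lemma dual_expectation_apply:
  fixes G :: "'a \<Rightarrow> ('w::real_normed_vector \<Rightarrow>\<^sub>L real)"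
  assumes meas: "\<And>z. (\<lambda>\<omega>. G \<omega> z) \<in> borel_measurable M"
    and bound: "\<And>\<omega>. norm (G \<omega>) \<le> \<zeta> \<omega>" and int: "integrable M \<zeta>"
  shows "blinfun_apply (dual_expectation M G) z = (\<integral>\<omega>. G \<omega> z \<partial>M)"
proof -
  have le: "\<bar>G \<omega> y\<bar> \<le> \<zeta> \<omega> * norm y" for \<omega> y
    using norm_blinfun[of "G \<omega>" y] mult_right_mono[OF bound[of \<omega>] norm_ge_zero[of y]] by simp
  have integrable: "integrable M (\<lambda>\<omega>. G \<omega> y)" for y
  proof (rule Bochner_Integration.integrable_bound[OF _ meas])
    show "integrable M (\<lambda>\<omega>. \<zeta> \<omega> * norm y)" using int by simp
    show "AE \<omega> in M. norm (G \<omega> y) \<le> norm (\<zeta> \<omega> * norm y)"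
      using order_trans[OF le abs_ge_self] by (intro AE_I2) simp
  qed
  have "bounded_linear (\<lambda>y. \<integral>\<omega>. G \<omega> y \<partial>M)"
  proof (rule bounded_linear_intro[where K="\<integral>\<omega>. \<zeta> \<omega> \<partial>M"])
    fix y
    have "\<bar>\<integral>\<omega>. G \<omega> y \<partial>M\<bar> \<le> (\<integral>\<omega>. \<bar>G \<omega> y\<bar> \<partial>M)"
      by (rule integral_abs_bound)
    also have "\<dots> \<le> (\<integral>\<omega>. \<zeta> \<omega> * norm y \<partial>M)" using integrable int le by (intro integral_mono) auto
    finally show "norm (\<integral>\<omega>. G \<omega> y \<partial>M) \<le> norm y * (\<integral>\<omega>. \<zeta> \<omega> \<partial>M)"
      by (simp add: mult.commute)
  qed (use integrable in \<open>simp_all add: blinfun.add_right blinfun.scaleR_right\<close>)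
  then show ?thesis unfolding dual_expectation_def by (simp add: bounded_linear_Blinfun_apply)
qed

lemma dual_expectation_distr_apply:
  fixes G :: "'b \<Rightarrow> ('w::real_normed_vector \<Rightarrow>\<^sub>L real)"
  assumes \<xi>: "\<xi> \<in> M \<rightarrow>\<^sub>M N" and meas: "\<And>z. (\<lambda>x. G x z) \<in> borel_measurable N"
    and bound: "\<And>x. norm (G x) \<le> \<zeta> x" and int: "integrable (distr M N \<xi>) \<zeta>"
  shows "blinfun_apply (dual_expectation M (\<lambda>\<omega>. G (\<xi> \<omega>))) z = (\<integral>x. G x z \<partial>distr M N \<xi>)"
proof -
  have "\<zeta> \<in> borel_measurable N" using borel_measurable_integrable[OF int] by simp
  then have "integrable M (\<lambda>\<omega>. \<zeta> (\<xi> \<omega>))" using integrable_distr_eq[OF \<xi>] int by blast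
  then show ?thesis
    using integral_distr[OF \<xi> meas] measurable_compose[OF \<xi> meas] bound
    by (subst dual_expectation_apply[where \<zeta>="\<lambda>\<omega>. \<zeta> (\<xi> \<omega>)"]) simp_all
qed

section \<open>Consistency for composite problems\<close>

locale composite_gap =
  fixes B :: "'u::{real_inner, complete_space, second_countable_topology} \<Rightarrow> 'w::real_normed_vector"
    and Bstar :: "('w \<Rightarrow>\<^sub>L real) \<Rightarrow> 'u" and \<psi> :: "'u \<Rightarrow> ereal"
  assumes B_compact: "compact_operator B"
    and Bstar_adjoint: "inner (Bstar \<phi>) u = \<phi> (B u)"
    and psi_proper: "proper_fun \<psi>" and psi_closed: "closed_fun \<psi>" and psi_convex: "convex_fun \<psi>"
    and dom_bounded: "bounded (dom_fun \<psi>)"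
begin

definition pairing_set :: "real \<Rightarrow> ('w \<times> 'w) set" where
  "pairing_set t = (B ` sublevel \<psi> t) \<times> closure (B ` dom_fun \<psi>)"

lemma bounded_sublevel: "bounded (sublevel \<psi> t)"
  using dom_bounded by (rule bounded_subset) (auto intro: in_sublevel_imp_dom)

lemma compact_closure_image_dom: "compact (closure (B ` dom_fun \<psi>))"
  using B_compact dom_bounded by (rule compact_operator_compact_closure_image)

lemma compact_pairing_set: "compact (pairing_set t)"
  unfolding pairing_set_def
  by (intro compact_Times compact_closure_image_dom compact_operator_image_compact[OF B_compact]
      closed_sublevel convex_sublevel psi_closed psi_convex bounded_sublevel)

lemma fst_pairing_set: "k \<in> pairing_set t \<Longrightarrow> fst k \<in> B ` dom_fun \<psi>"
  by (auto simp: pairing_set_def intro: in_sublevel_imp_dom)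

lemma in_pairing_setI: "u \<in> sublevel \<psi> t \<Longrightarrow> v \<in> dom_fun \<psi> \<Longrightarrow> (B u, B v) \<in> pairing_set t"
  unfolding pairing_set_def by (auto intro: subsetD[OF closure_subset])

lemma inner_Bstar_diff: "inner (Bstar \<phi>) (u - v) = \<phi> (B u) - \<phi> (B v)"
  by (simp add: inner_diff_right Bstar_adjoint)

lemma gap_tendsto_zero:
  fixes G :: "nat \<Rightarrow> 'w \<Rightarrow> ('w \<Rightarrow>\<^sub>L real)" and g :: "'w \<Rightarrow> ('w \<Rightarrow>\<^sub>L real)"
  assumes unif: "uniform_limit (pairing_set t) (\<lambda>n k. G n (fst k) (snd k))
      (\<lambda>k. g (fst k) (snd k)) sequentially"
    and x: "\<forall>\<^sub>F n in sequentially. x n \<in> sublevel \<psi> t"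
    and gap: "eventually_gap_le \<psi> (\<lambda>n u. Bstar (G n (B u))) \<epsilon> x"
    and \<epsilon>: "\<epsilon> \<longlonglongrightarrow> 0"
  shows "(\<lambda>n. gap \<psi> (Bstar (g (B (x n)))) (x n)) \<longlonglongrightarrow> 0"
proof (rule order_tendstoI)
  fix a :: ereal assume "a < 0"
  show "\<forall>\<^sub>F n in sequentially. a < gap \<psi> (Bstar (g (B (x n)))) (x n)"
    using x by eventually_elim
      (rule less_le_trans[OF \<open>a < 0\<close> gap_nonneg[OF in_sublevel_imp_dom]])
next
  fix a :: ereal assume "0 < a"
  then obtain e where e: "0 < e" "ereal e < a"
    using ereal_dense2[of 0 a] by (auto simp: zero_ereal_def)
  have "\<forall>\<^sub>F n in sequentially. \<epsilon> n < e / 2"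
    using \<epsilon> e(1) by (intro order_tendstoD(2)) auto
  moreover have "\<forall>\<^sub>F n in sequentially. \<forall>k\<in>pairing_set t.
      dist (G n (fst k) (snd k)) (g (fst k) (snd k)) < e / 4"
    using uniform_limitD[OF unif, of "e / 4"] e(1) by simp
  ultimately show "\<forall>\<^sub>F n in sequentially. gap \<psi> (Bstar (g (B (x n)))) (x n) < a"
    using x gap[unfolded eventually_gap_le_def]
  proof eventually_elim
    case (elim n)
    have close: "\<bar>G n (B (x n)) (B v) - g (B (x n)) (B v)\<bar> < e / 4"
      if "v \<in> dom_fun \<psi>" for v
      using bspec[OF elim(2) in_pairing_setI[OF elim(3) that]] by (simp add: dist_real_def)
    have "gap \<psi> (Bstar (g (B (x n)))) (x n) \<le> ereal (\<epsilon> n + e / 2)"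
      using elim(4)[THEN conjunct2]
    proof (rule gap_le_add)
      fix v assume "v \<in> dom_fun \<psi>"
      then show "inner (Bstar (g (B (x n)))) (x n - v)
          \<le> inner (Bstar (G n (B (x n)))) (x n - v) + e / 2"
        using close[of v] close[OF in_sublevel_imp_dom[OF elim(3)]]
        unfolding inner_Bstar_diff by linarith
    qed
    also have "\<dots> \<le> ereal e" using elim(1) by simp
    finally show ?case using e(2) by (rule le_less_trans)
  qed
qed

lemma weak_accumulation_point_gap_zero:
  fixes g :: "'w \<Rightarrow> ('w \<Rightarrow>\<^sub>L real)"
  assumes cont: "continuous_on (pairing_set t) (\<lambda>k. g (fst k) (snd k))"
    and x: "\<forall>\<^sub>F n in sequentially. x n \<in> sublevel \<psi> t"
    and gap: "(\<lambda>n. gap \<psi> (Bstar (g (B (x n)))) (x n)) \<longlonglongrightarrow> 0"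
    and u: "weak_accumulation_point x u"
  shows "u \<in> dom_fun \<psi> \<and> gap \<psi> (Bstar (g (B u))) u = 0"
proof -
  obtain r where r: "strict_mono r" and weak: "weakly_converges (x \<circ> r) u"
    using u unfolding weak_accumulation_point_def by blast
  have x_r: "\<forall>\<^sub>F n in sequentially. (x \<circ> r) n \<in> sublevel \<psi> t"
    using eventually_subseq[OF r x] by simp
  have bounded: "bounded (range (x \<circ> r))"
    using x_r bounded_sublevel by (rule eventually_bounded_imp_bounded_range)
  have u_t: "u \<in> sublevel \<psi> t"
    by (rule weak_limit_in_closed_convex[OF bounded weak closed_sublevel[OF psi_closed]
          convex_sublevel[OF psi_convex] x_r])
  have lim_B: "(\<lambda>n. B ((x \<circ> r) n)) \<longlonglongrightarrow> B u"
    using B_compact bounded weak by (rule compact_operator_weak_to_strong)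
  have lim_pairing: "(\<lambda>n. g (B ((x \<circ> r) n)) (B (v n))) \<longlonglongrightarrow> g (B u) (B w)"
    if "(\<lambda>n. B (v n)) \<longlonglongrightarrow> B w" "w \<in> dom_fun \<psi>" "\<forall>\<^sub>F n in sequentially. v n \<in> dom_fun \<psi>" for v w
  proof -
    have "\<forall>\<^sub>F n in sequentially. (B ((x \<circ> r) n), B (v n)) \<in> pairing_set t"
      using x_r that(3) by eventually_elim (rule in_pairing_setI)
    from continuous_on_tendsto_compose[OF cont tendsto_Pair[OF lim_B that(1)]
        in_pairing_setI[OF u_t that(2)] this]
    show ?thesis by simp
  qed
  have dom: "\<forall>\<^sub>F n in sequentially. (x \<circ> r) n \<in> dom_fun \<psi>"
    using x_r by eventually_elim (rule in_sublevel_imp_dom)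
  show ?thesis
  proof (rule gap_zero_of_weak_limit[OF psi_proper psi_closed psi_convex bounded weak dom])
    show "(\<lambda>n. gap \<psi> (Bstar (g (B ((x \<circ> r) n)))) ((x \<circ> r) n)) \<longlonglongrightarrow> 0"
      using LIMSEQ_subseq_LIMSEQ[OF gap r] by (simp add: comp_def)
    show "(\<lambda>n. inner (Bstar (g (B ((x \<circ> r) n)))) ((x \<circ> r) n - v)) \<longlonglongrightarrow> inner (Bstar (g (B u))) (u - v)"
      if "v \<in> dom_fun \<psi>" for v
      unfolding inner_Bstar_diff using that dom in_sublevel_imp_dom[OF u_t]
      by (intro tendsto_diff lim_pairing lim_B tendsto_const) auto
  qed
qed

end

locale stochastic_composite_gap = composite_gap B Bstar \<psi> + prob_space M
  for B :: "'u::{real_inner, complete_space, second_countable_topology}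
      \<Rightarrow> 'w::{real_normed_vector, second_countable_topology}"
    and Bstar :: "('w \<Rightarrow>\<^sub>L real) \<Rightarrow> 'u" and \<psi> :: "'u \<Rightarrow> ereal" and M :: "'a measure" +
  fixes S Q :: "'x measure" and Z :: "nat \<Rightarrow> 'a \<Rightarrow> 'x"
    and G :: "'w \<Rightarrow> 'x \<Rightarrow> ('w \<Rightarrow>\<^sub>L real)" and \<zeta> :: "'x \<Rightarrow> real" and g :: "'w \<Rightarrow> ('w \<Rightarrow>\<^sub>L real)"
  assumes iid: "iid_vars S Q Z {1..}"
    and G_cont: "continuous_on (B ` dom_fun \<psi>) (\<lambda>w. G w x)"
    and G_meas: "w \<in> B ` dom_fun \<psi> \<Longrightarrow> (\<lambda>x. G w x z) \<in> borel_measurable Q"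
    and G_bound: "w \<in> B ` dom_fun \<psi> \<Longrightarrow> norm (G w x) \<le> \<zeta> x"
    and \<zeta>_int: "integrable Q \<zeta>"
    and g_apply: "w \<in> B ` dom_fun \<psi> \<Longrightarrow> g w z = (\<integral>x. G w x z \<partial>Q)"
begin

definition empirical_gradient :: "'a \<Rightarrow> nat \<Rightarrow> 'u \<Rightarrow> 'u" where
  "empirical_gradient \<omega> N u = Bstar (sample_mean Z (G (B u)) N \<omega>)"

lemma continuous_on_pairing:
  "continuous_on (pairing_set t) (\<lambda>k. G (fst k) x (snd k))"
proof (intro bounded_bilinear.continuous_on[OF bounded_bilinear_blinfun_apply]
    continuous_on_snd continuous_on_id)
  show "continuous_on (pairing_set t) (\<lambda>k. G (fst k) x)"
    by (rule continuous_on_compose2[OF G_cont continuous_on_fst[OF continuous_on_id]])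
       (use fst_pairing_set in blast)
qed

text \<open>Only the real-valued pairings are averaged, so neither integration nor a law of large numbers
  in the possibly non-separable dual space is needed.\<close>

lemma AE_uniform_limit_pairing:
  "AE \<omega> in M. uniform_limit (pairing_set t)
     (\<lambda>N k. blinfun_apply (sample_mean Z (G (fst k)) N \<omega>) (snd k))
     (\<lambda>k. g (fst k) (snd k)) sequentially"
proof -
  obtain b where b: "\<And>z. z \<in> closure (B ` dom_fun \<psi>) \<Longrightarrow> norm z \<le> b"
    using compact_imp_bounded[OF compact_closure_image_dom] by (auto simp: bounded_iff)
  have "AE \<omega> in M. uniform_limit (pairing_set t)
      (\<lambda>N k. sample_mean Z (\<lambda>x. G (fst k) x (snd k)) N \<omega>)
      (\<lambda>k. \<integral>x. G (fst k) x (snd k) \<partial>Q) sequentially"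
  proof (rule uniform_law_of_large_numbers[OF iid compact_pairing_set continuous_on_pairing])
    show "integrable Q (\<lambda>x. \<zeta> x * b)" using \<zeta>_int by simp
    fix k assume k: "k \<in> pairing_set t"
    note dom = fst_pairing_set[OF k]
    show "(\<lambda>x. G (fst k) x (snd k)) \<in> borel_measurable Q" using dom by (rule G_meas)
    show "\<bar>G (fst k) x (snd k)\<bar> \<le> \<zeta> x * b" for x
    proof -
      have "\<bar>G (fst k) x (snd k)\<bar> \<le> norm (G (fst k) x) * norm (snd k)"
        using norm_blinfun[of "G (fst k) x" "snd k"] by simp
      also have "\<dots> \<le> \<zeta> x * b"
        using G_bound[OF dom] b k
        by (intro mult_mono order_trans[OF norm_ge_zero G_bound[OF dom]]) (auto simp: pairing_set_def)
      finally show ?thesis .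
    qed
  qed
  moreover have "uniform_limit (pairing_set t) F (\<lambda>k. \<integral>x. G (fst k) x (snd k) \<partial>Q) sequentially
      \<longleftrightarrow> uniform_limit (pairing_set t) F (\<lambda>k. g (fst k) (snd k)) sequentially" for F
    by (intro uniform_limit_cong') (simp_all add: g_apply fst_pairing_set)
  ultimately show ?thesis by (simp add: blinfun_apply_sample_mean)
qed

lemma AE_empirical_gap_le_imp_sublevel:
  assumes \<epsilon>: "\<epsilon> \<longlonglongrightarrow> 0"
  obtains t where "AE \<omega> in M. \<forall>x. eventually_gap_le \<psi> (empirical_gradient \<omega>) \<epsilon> x \<longrightarrow>
    (\<forall>\<^sub>F N in sequentially. x N \<in> sublevel \<psi> t)"
proof -
  obtain v where v: "v \<in> dom_fun \<psi>" using psi_proper by (auto simp: proper_fun_def)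
  obtain b where b: "\<And>u. u \<in> dom_fun \<psi> \<Longrightarrow> norm (B u) \<le> b"
    using compact_imp_bounded[OF compact_closure_image_dom] closure_subset[of "B ` dom_fun \<psi>"]
    by (force simp: bounded_iff)
  let ?E = "(\<integral>x. \<zeta> x \<partial>Q) + 1"
  have "AE \<omega> in M. (\<lambda>N. sample_mean Z \<zeta> N \<omega>) \<longlonglongrightarrow> (\<integral>x. \<zeta> x \<partial>Q)"
    by (rule strong_law_sample_mean[OF iid \<zeta>_int])
  then have "AE \<omega> in M. \<forall>x. eventually_gap_le \<psi> (empirical_gradient \<omega>) \<epsilon> x \<longrightarrow>
    (\<forall>\<^sub>F N in sequentially. x N \<in> sublevel \<psi> (real_of_ereal (\<psi> v) + ?E * (b + b) + 1))"
  proof (eventually_elim, intro allI impI)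
    fix \<omega> x
    assume lim: "(\<lambda>N. sample_mean Z \<zeta> N \<omega>) \<longlonglongrightarrow> (\<integral>x. \<zeta> x \<partial>Q)"
      and x: "eventually_gap_le \<psi> (empirical_gradient \<omega>) \<epsilon> x"
    have "\<forall>\<^sub>F N in sequentially. sample_mean Z \<zeta> N \<omega> < ?E"
      using lim by (rule order_tendstoD(2)) simp
    moreover have "\<forall>\<^sub>F N in sequentially. \<epsilon> N < 1" using \<epsilon> by (rule order_tendstoD(2)) simp
    ultimately show "\<forall>\<^sub>F N in sequentially. x N \<in> sublevel \<psi> (real_of_ereal (\<psi> v) + ?E * (b + b) + 1)"
      using x[unfolded eventually_gap_le_def empirical_gradient_def]
    proof eventually_elim
      case (elim N)
      then have x_dom: "x N \<in> dom_fun \<psi>" by simp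
      let ?\<phi> = "sample_mean Z (G (B (x N))) N \<omega>"
      have "norm ?\<phi> \<le> ?E"
        using norm_sample_mean_le[of "G (B (x N))" \<zeta> Z N \<omega>] G_bound x_dom elim(1) by force
      then have "norm ?\<phi> * norm (B v - B (x N)) \<le> ?E * (b + b)"
        using b[OF v] b[OF x_dom] norm_triangle_ineq4[of "B v" "B (x N)"]
        by (intro mult_mono order_trans[OF norm_ge_zero]) auto
      then have "inner (Bstar ?\<phi>) (v - x N) \<le> ?E * (b + b)"
        using norm_blinfun[of ?\<phi> "B v - B (x N)"] by (simp add: inner_Bstar_diff blinfun.diff_right)
      then show ?case
        using elim(2,3) by (intro gap_le_imp_sublevel[OF psi_proper x_dom v]) (auto intro: order_trans)
    qed
  qed
  then show ?thesis by (rule that)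
qed

theorem AE_gap_consistency:
  assumes \<epsilon>: "\<epsilon> \<longlonglongrightarrow> 0"
  shows "AE \<omega> in M. \<forall>x. eventually_gap_le \<psi> (empirical_gradient \<omega>) \<epsilon> x \<longrightarrow>
    (\<lambda>N. gap \<psi> (Bstar (g (B (x N)))) (x N)) \<longlonglongrightarrow> 0 \<and> (\<exists>u. weak_accumulation_point x u) \<and>
    (\<forall>u. weak_accumulation_point x u \<longrightarrow> u \<in> dom_fun \<psi> \<and> gap \<psi> (Bstar (g (B u))) u = 0)"
proof -
  obtain t where "AE \<omega> in M. \<forall>x. eventually_gap_le \<psi> (empirical_gradient \<omega>) \<epsilon> x \<longrightarrow>
      (\<forall>\<^sub>F N in sequentially. x N \<in> sublevel \<psi> t)"
    using \<epsilon> by (rule AE_empirical_gap_le_imp_sublevel)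
  then show ?thesis
    using AE_uniform_limit_pairing[of t]
  proof (eventually_elim, intro allI impI)
    fix \<omega> x
    assume confined: "\<forall>x. eventually_gap_le \<psi> (empirical_gradient \<omega>) \<epsilon> x \<longrightarrow>
          (\<forall>\<^sub>F N in sequentially. x N \<in> sublevel \<psi> t)"
      and unif: "uniform_limit (pairing_set t)
          (\<lambda>N k. blinfun_apply (sample_mean Z (G (fst k)) N \<omega>) (snd k))
          (\<lambda>k. g (fst k) (snd k)) sequentially"
      and x: "eventually_gap_le \<psi> (empirical_gradient \<omega>) \<epsilon> x"
    have x_t: "\<forall>\<^sub>F N in sequentially. x N \<in> sublevel \<psi> t" using confined x by blast
    have lim: "(\<lambda>N. gap \<psi> (Bstar (g (B (x N)))) (x N)) \<longlonglongrightarrow> 0"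
      using x by (intro gap_tendsto_zero[OF unif x_t _ \<epsilon>]) (simp add: empirical_gradient_def[abs_def])
    have "continuous_on (pairing_set t) (\<lambda>k. g (fst k) (snd k))"
    proof (rule uniform_limit_theorem[OF _ unif])
      show "\<forall>\<^sub>F N in sequentially. continuous_on (pairing_set t)
          (\<lambda>k. blinfun_apply (sample_mean Z (G (fst k)) N \<omega>) (snd k))"
        unfolding blinfun_apply_sample_mean
        by (intro always_eventually allI continuous_on_sample_mean continuous_on_pairing)
    qed simp
    then show "(\<lambda>N. gap \<psi> (Bstar (g (B (x N)))) (x N)) \<longlonglongrightarrow> 0 \<and>
        (\<exists>u. weak_accumulation_point x u) \<and>
        (\<forall>u. weak_accumulation_point x u \<longrightarrow> u \<in> dom_fun \<psi> \<and> gap \<psi> (Bstar (g (B u))) u = 0)"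
      using lim weak_accumulation_point_gap_zero[OF _ x_t lim]
        eventually_bounded_imp_weak_accumulation_point[OF x_t bounded_sublevel] by blast
  qed
qed

end

theorem theorem3p6:
  fixes B :: "'u::{real_inner, complete_space, second_countable_topology} \<Rightarrow> 'w::{banach, second_countable_topology}"
    and Bstar :: "('w \<Rightarrow>\<^sub>L real) \<Rightarrow> 'u"
    and \<psi> :: "'u \<Rightarrow> ereal"
    and U0 :: "'u set"
    and M :: "'a measure"
    and \<xi> :: "'a \<Rightarrow> 'x::polish_space"
    and \<xi>s :: "nat \<Rightarrow> 'a \<Rightarrow> 'x"
    and f :: "'w \<Rightarrow> 'x \<Rightarrow> real"
    and \<zeta>f :: "'x \<Rightarrow> real"
    and gradg :: "'x \<Rightarrow> 'u \<Rightarrow> 'u"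
    and Dwf :: "'w \<Rightarrow> 'x \<Rightarrow> ('w \<Rightarrow>\<^sub>L real)"
    and \<zeta>Df :: "'x \<Rightarrow> real"
    and DF :: "'w \<Rightarrow> ('w \<Rightarrow>\<^sub>L real)"
    and DFhat :: "nat \<Rightarrow> 'a \<Rightarrow> 'w \<Rightarrow> ('w \<Rightarrow>\<^sub>L real)"
    and \<epsilon> :: "nat \<Rightarrow> real"
    and ubar :: "nat \<Rightarrow> 'a \<Rightarrow> 'u"
  assumes B_compact: "compact_operator B"
    and Bstar_adjoint: "\<And>\<phi> u. inner (Bstar \<phi>) u = blinfun_apply \<phi> (B u)"
    and psi_nonneg: "\<And>u. \<psi> u \<ge> 0"
    and psi_proper: "proper_fun \<psi>"
    and psi_closed: "closed_fun \<psi>"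
    and psi_convex: "convex_fun \<psi>"
    and dom_bounded: "bounded (dom_fun \<psi>)"
    and U0_open: "open U0" and U0_convex: "convex U0" and U0_bounded: "bounded U0"
    and dom_sub: "dom_fun \<psi> \<subseteq> U0"
    and M_prob: "prob_space M"
    and M_complete: "complete_measure M"
    and \<xi>_meas: "\<xi> \<in> M \<rightarrow>\<^sub>M borel"
    and \<xi>s_meas: "\<And>i. i \<ge> 1 \<Longrightarrow> \<xi>s i \<in> M \<rightarrow>\<^sub>M borel"
    and \<xi>s_distr: "\<And>i. i \<ge> 1 \<Longrightarrow> distr M borel (\<xi>s i) = distr M borel \<xi>"
    and \<xi>s_indep: "prob_space.indep_vars M (\<lambda>_. borel) \<xi>s {1..}"
    and f_cont: "\<And>x. continuous_on (B ` dom_fun \<psi>) (\<lambda>w. f w x)"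
    and f_meas: "\<And>w. w \<in> B ` U0 \<Longrightarrow> f w \<in> borel_measurable borel"
    and f_bound: "\<And>u x. u \<in> U0 \<Longrightarrow> \<bar>f (B u) x\<bar> \<le> \<zeta>f x"
    and \<zeta>f_int: "integrable (distr M borel \<xi>) \<zeta>f"
    and g_deriv: "\<And>x u. u \<in> U0 \<Longrightarrow>
        ((\<lambda>v. f (B v) x) has_derivative (\<lambda>h. inner (gradg x u) h)) (at u)"
    and g_C1: "\<And>x. continuous_on U0 (gradg x)"
    and Dwf_cont: "\<And>x. continuous_on (B ` dom_fun \<psi>) (\<lambda>w. Dwf w x)"
    and Dwf_meas: "\<And>w. w \<in> B ` dom_fun \<psi> \<Longrightarrow> Dwf w \<in> borel_measurable borel"
    and grad_eq: "\<And>x u. u \<in> dom_fun \<psi> \<Longrightarrow> gradg x u = Bstar (Dwf (B u) x)"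
    and \<zeta>Df_nonneg: "\<And>x. \<zeta>Df x \<ge> 0"
    and \<zeta>Df_int: "integrable (distr M borel \<xi>) \<zeta>Df"
    and grad_bound: "\<And>x u. u \<in> U0 \<Longrightarrow> norm (gradg x u) \<le> \<zeta>Df x"
    and Dwf_bound: "\<And>x u. u \<in> dom_fun \<psi> \<Longrightarrow> norm (Dwf (B u) x) \<le> \<zeta>Df x"
    and DF_def: "\<And>w. w \<in> B ` dom_fun \<psi> \<Longrightarrow> DF w = dual_expectation M (\<lambda>\<omega>. Dwf w (\<xi> \<omega>))"
    and DFhat_def: "\<And>N \<omega> w. w \<in> B ` dom_fun \<psi> \<Longrightarrow>
        DFhat N \<omega> w = (1 / real N) *\<^sub>R (\<Sum>i\<in>{1..N}. Dwf w (\<xi>s i \<omega>))"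
    and \<epsilon>_nonneg: "\<And>N. \<epsilon> N \<ge> 0"
    and \<epsilon>_lim: "\<epsilon> \<longlonglongrightarrow> 0"
    and ubar_meas: "\<And>N. N \<ge> 1 \<Longrightarrow> ubar N \<in> borel_measurable M"
    and ubar_dom: "\<And>N \<omega>. N \<ge> 1 \<Longrightarrow> \<omega> \<in> space M \<Longrightarrow> ubar N \<omega> \<in> dom_fun \<psi>"
    and ubar_gap: "\<And>N. N \<ge> 1 \<Longrightarrow>
        (AE \<omega> in M. gap \<psi> (Bstar (DFhat N \<omega> (B (ubar N \<omega>)))) (ubar N \<omega>) \<le> ereal (\<epsilon> N))"
  shows "(AE \<omega> in M. (\<lambda>N. gap \<psi> (Bstar (DF (B (ubar N \<omega>)))) (ubar N \<omega>)) \<longlonglongrightarrow> 0)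
    \<and> (AE \<omega> in M. (\<exists>u. weak_accumulation_point (\<lambda>N. ubar N \<omega>) u)
         \<and> (\<forall>u. weak_accumulation_point (\<lambda>N. ubar N \<omega>) u \<longrightarrow>
               u \<in> dom_fun \<psi> \<and> gap \<psi> (Bstar (DF (B u))) u = 0))"
proof -
  interpret prob_space M by (rule M_prob)
  interpret stochastic_composite_gap B Bstar \<psi> M borel "distr M borel \<xi>" \<xi>s Dwf \<zeta>Df DF
  proof unfold_locales
    show "iid_vars borel (distr M borel \<xi>) \<xi>s {1..}" using \<xi>s_indep \<xi>s_distr by (simp add: iid_vars_def)
    fix w z assume w: "w \<in> B ` dom_fun \<psi>"
    have meas: "(\<lambda>x. Dwf w x z) \<in> borel_measurable borel" for z
      using Dwf_meas[OF w] by (rule borel_measurable_blinfun_apply)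
    then show "(\<lambda>x. Dwf w x z) \<in> borel_measurable (distr M borel \<xi>)" by simp
    show bound: "norm (Dwf w x) \<le> \<zeta>Df x" for x using w Dwf_bound by blast
    show "DF w z = (\<integral>x. Dwf w x z \<partial>distr M borel \<xi>)"
      unfolding DF_def[OF w] by (rule dual_expectation_distr_apply[OF \<xi>_meas meas bound \<zeta>Df_int])
  qed (rule B_compact Bstar_adjoint psi_proper psi_closed psi_convex dom_bounded Dwf_cont \<zeta>Df_int)+
  have empirical: "Bstar (DFhat N \<omega> (B u)) = empirical_gradient \<omega> N u" if "u \<in> dom_fun \<psi>" for N \<omega> u
    using that by (simp add: DFhat_def sample_mean_def empirical_gradient_def)
  have "AE \<omega> in M. \<forall>N\<ge>1. gap \<psi> (Bstar (DFhat N \<omega> (B (ubar N \<omega>)))) (ubar N \<omega>) \<le> ereal (\<epsilon> N)"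
    using ubar_gap by (simp add: AE_all_countable)
  then have "AE \<omega> in M. eventually_gap_le \<psi> (empirical_gradient \<omega>) \<epsilon> (\<lambda>N. ubar N \<omega>)"
    unfolding eventually_gap_le_def using AE_space
    by eventually_elim
      (auto simp: eventually_sequentially ubar_dom simp flip: empirical intro!: exI[of _ 1])
  with AE_gap_consistency[OF \<epsilon>_lim] show ?thesis
    unfolding AE_conj_iff[symmetric]
  proof eventually_elim
    case (elim \<omega>)
    show ?case by (rule elim(1)[rule_format, OF elim(2)])
  qed
qed

end
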